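(* Let $\mathbb{K}$ be a field of characteristic $0$ and $\mathcal{H}$ the $\mathbb{K}$-vector space freely spanned by totally assigned graphs (TAGs), with product $m\big((\Gamma_1,\mu_1),(\Gamma_2,\mu_2)\big)=(\Gamma_1\sqcup\Gamma_2,\mu_1\sqcup\mu_2)$, unit $1_{\mathcal{H}}$ the empty graph, coproduct $\Delta\big((\Gamma,\mu)\big)=\sum_{\emptyset\subseteq(\gamma,\nu)\subseteq(\Gamma,\mu)}(\gamma,\nu)\otimes(\Gamma/\gamma,\mu/\nu)$, and counit $\epsilon$ with $\epsilon(1_{\mathcal{H}})=1$ and $\epsilon\big((\Gamma,\mu)\big)=0$ for every TAG $(\Gamma,\mu)\neq 1_{\mathcal{H}}$. Then $(\mathcal{H},m,1_{\mathcal{H}},\Delta,\epsilon)$ is a bialgebra.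
   Context: Graphs are finite, possibly disconnected, with loops and multiple edges allowed; $E(\Gamma)$ is the edge set. A TAG is a pair $(\Gamma,\mu)$ where $\mu$ is a total order on $E(\Gamma)$. $\mu_1\sqcup\mu_2$ is the ordinal sum order on $E(\Gamma_1)\sqcup E(\Gamma_2)$: it restricts to $\mu_i$ on $E(\Gamma_i)$ and every edge of $\Gamma_1$ precedes every edge of $\Gamma_2$. A subgraph $\gamma$ of $\Gamma$ is formed by a subset of $E(\Gamma)$ together with the vertices incident to these edges; a totally assigned subgraph $(\gamma,\nu)$ carries $\nu=\mu|_{E(\gamma)}$. The shrinking $(\Gamma/\gamma,\mu/\nu)$: contract each connected component of $\gamma$ to a point, and restrict $\mu$ to the edges of $\Gamma$ not in $\gamma$.
   Formalization: TAGs are taken up to isomorphism and up to isolated vertices, so Γ/Γ equals the empty graph; if isolated vertices counted, the right counit law would fail, e.g. for a single edge Γ, where Γ/Γ is a point and ε of it is 0. *)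

theory Defs
  imports Complex_Main "HOL-Library.Poly_Mapping"
begin

section \<open>Totally assigned graphs\<close>

text \<open>
  Edges are undirected: \<open>ends G e\<close> is the set of endpoints of \<open>e\<close>, a singleton when \<open>e\<close> is a
  loop. Different edges may have the same endpoints.
\<close>

record ('v, 'e) graph =
  verts :: "'v set"
  edges :: "'e set"
  ends :: "'e \<Rightarrow> 'v set"

definition is_graph :: "('v, 'e) graph \<Rightarrow> bool" where
  "is_graph G \<longleftrightarrow> finite (verts G) \<and> finite (edges G) \<and>
     (\<forall>e\<in>edges G. ends G e \<subseteq> verts G \<and> card (ends G e) \<in> {1, 2})"

type_synonym ('v, 'e) tag = "('v, 'e) graph \<times> 'e rel"

definition is_tag :: "('v, 'e) tag \<Rightarrow> bool" where
  "is_tag T \<longleftrightarrow> is_graph (fst T) \<and> linear_order_on (edges (fst T)) (snd T)"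

definition empty_tag :: "('v, 'e) tag" where
  "empty_tag = (\<lparr>verts = {}, edges = {}, ends = (\<lambda>_. {})\<rparr>, {})"

definition disj_graph :: "('v, 'e) graph \<Rightarrow> ('w, 'f) graph \<Rightarrow> ('v + 'w, 'e + 'f) graph" where
  "disj_graph G H = \<lparr>verts = verts G <+> verts H, edges = edges G <+> edges H,
     ends = case_sum (\<lambda>e. Inl ` ends G e) (\<lambda>e. Inr ` ends H e)\<rparr>"

definition disj_tag :: "('v, 'e) tag \<Rightarrow> ('w, 'f) tag \<Rightarrow> ('v + 'w, 'e + 'f) tag" where
  "disj_tag S T = (disj_graph (fst S) (fst T),
     map_prod Inl Inl ` snd S \<union> map_prod Inr Inr ` snd T
     \<union> (Inl ` edges (fst S)) \<times> (Inr ` edges (fst T)))"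

definition subgraph :: "('v, 'e) graph \<Rightarrow> 'e set \<Rightarrow> ('v, 'e) graph" where
  "subgraph G A = \<lparr>verts = (\<Union>e\<in>A. ends G e), edges = A, ends = ends G\<rparr>"

definition subtag :: "('v, 'e) tag \<Rightarrow> 'e set \<Rightarrow> ('v, 'e) tag" where
  "subtag T A = (subgraph (fst T) A, Restr (snd T) A)"

definition adjacency :: "('v, 'e) graph \<Rightarrow> 'v rel" where
  "adjacency G = {(u, w). \<exists>e\<in>edges G. ends G e = {u, w}}"

definition component :: "('v, 'e) graph \<Rightarrow> 'v \<Rightarrow> 'v set" where
  "component G v = (adjacency G)\<^sup>* `` {v}"

text \<open>
  A vertex of the shrinking is a set of vertices of \<open>G\<close>: a connected component of the subgraph
  with edge set \<open>A\<close>, or \<open>{v}\<close> for a vertex \<open>v\<close> outside that subgraph.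
\<close>

definition shrink_graph :: "('v, 'e) graph \<Rightarrow> 'e set \<Rightarrow> ('v set, 'e) graph" where
  "shrink_graph G A = \<lparr>verts = component (subgraph G A) ` verts G, edges = edges G - A,
     ends = (\<lambda>e. component (subgraph G A) ` ends G e)\<rparr>"

definition shrink_tag :: "('v, 'e) tag \<Rightarrow> 'e set \<Rightarrow> ('v set, 'e) tag" where
  "shrink_tag T A = (shrink_graph (fst T) A, Restr (snd T) (edges (fst T) - A))"

lemma linear_order_on_subset_Restr:
  assumes "linear_order_on E r" "A \<subseteq> E"
  shows "linear_order_on A (Restr r A)"
  using assms unfolding linear_order_on_def partial_order_on_def preorder_on_def refl_on_def
      total_on_def antisym_def trans_def by blast

lemma is_tag_empty: "is_tag empty_tag"
  by (auto simp: is_tag_def is_graph_def empty_tag_def)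

lemma is_tag_subtag: "is_tag T \<Longrightarrow> A \<subseteq> edges (fst T) \<Longrightarrow> is_tag (subtag T A)"
  unfolding is_tag_def is_graph_def subtag_def subgraph_def
  by (auto intro!: linear_order_on_subset_Restr intro: finite_subset)

lemma is_tag_shrink_tag:
  assumes T: "is_tag T"
  shows "is_tag (shrink_tag T A)"
proof -
  have c: "card (f ` X) \<in> {1, 2}" if "card X \<in> {1, 2}" for f :: "'a \<Rightarrow> 'a set" and X
  proof -
    from that have "finite X" "X \<noteq> {}" by (auto intro: card_ge_0_finite)
    then have "card (f ` X) \<le> card X" "card (f ` X) \<noteq> 0" by (auto simp: card_image_le)
    with that show ?thesis by auto
  qed
  have "is_graph (shrink_graph (fst T) A)"
    using T c unfolding is_tag_def is_graph_def shrink_graph_def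
    by (simp del: insert_iff) blast
  moreover have "linear_order_on (edges (fst T) - A) (snd (shrink_tag T A))"
    using T unfolding is_tag_def shrink_tag_def
    by (auto intro: linear_order_on_subset_Restr)
  ultimately show ?thesis
    by (simp add: is_tag_def shrink_tag_def shrink_graph_def)
qed

lemma is_tag_disj_tag:
  assumes "is_tag S" "is_tag T"
  shows "is_tag (disj_tag S T)"
proof -
  have "is_graph (disj_graph (fst S) (fst T))"
    using assms by (simp add: is_tag_def is_graph_def disj_graph_def card_image Plus_def ball_Un image_iff) blast
  moreover have "linear_order_on (edges (fst S) <+> edges (fst T)) (snd (disj_tag S T))"
  proof -
    have 1: "linear_order_on (edges (fst S)) (snd S)" "linear_order_on (edges (fst T)) (snd T)"
      using assms by (auto simp: is_tag_def)
    have m: "(x, y) \<in> snd (disj_tag S T) \<longleftrightarrow>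
      (case (x, y) of (Inl a, Inl b) \<Rightarrow> (a, b) \<in> snd S | (Inr a, Inr b) \<Rightarrow> (a, b) \<in> snd T
       | (Inl a, Inr b) \<Rightarrow> a \<in> edges (fst S) \<and> b \<in> edges (fst T) | _ \<Rightarrow> False)" for x y
      by (cases x; cases y) (auto simp: disj_tag_def map_prod_def image_iff
          split: prod.splits intro: bexI)
    show ?thesis
      using 1 unfolding linear_order_on_def partial_order_on_def preorder_on_def
    proof (intro conjI; elim conjE)
      assume a: "snd S \<subseteq> edges (fst S) \<times> edges (fst S)" "snd T \<subseteq> edges (fst T) \<times> edges (fst T)"
      show "snd (disj_tag S T) \<subseteq> (edges (fst S) <+> edges (fst T)) \<times> (edges (fst S) <+> edges (fst T))"
        using a by (auto simp: m split: sum.splits)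
      assume t: "trans (snd S)" "trans (snd T)"
      show "trans (snd (disj_tag S T))"
        using a t by (intro transI) (auto simp: m split: sum.splits dest: transD)
    next
      assume "antisym (snd S)" "antisym (snd T)"
      then show "antisym (snd (disj_tag S T))"
        unfolding antisym_def m by (auto split: sum.splits)
    next
      assume "total_on (edges (fst S)) (snd S)" "total_on (edges (fst T)) (snd T)"
      then show "total_on (edges (fst S) <+> edges (fst T)) (snd (disj_tag S T))"
        unfolding total_on_def m by (auto split: sum.splits)
    next
      assume "refl_on (edges (fst S)) (snd S)" "refl_on (edges (fst T)) (snd T)"
      then show "refl_on (edges (fst S) <+> edges (fst T)) (snd (disj_tag S T))"
        unfolding refl_on_def m by (auto split: sum.splits)
    qed
  qed
  ultimately show ?thesis
    by (simp add: is_tag_def disj_tag_def disj_graph_def)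
qed


section \<open>Isomorphism classes\<close>

definition tag_iso :: "('v, 'e) tag \<Rightarrow> ('w, 'f) tag \<Rightarrow> bool" where
  "tag_iso S T \<longleftrightarrow> (\<exists>f g. bij_betw f (verts (fst S)) (verts (fst T))
     \<and> bij_betw g (edges (fst S)) (edges (fst T))
     \<and> (\<forall>e\<in>edges (fst S). ends (fst T) (g e) = f ` ends (fst S) e)
     \<and> (\<forall>e\<in>edges (fst S). \<forall>e'\<in>edges (fst S). (g e, g e') \<in> snd T \<longleftrightarrow> (e, e') \<in> snd S))"

text \<open>
  TAGs are identified when they are isomorphic after their isolated vertices have been removed,
  that is, when their subgraphs formed by all the edges are isomorphic. Without this, every
  \<open>\<Gamma>/\<gamma>\<close> with \<open>\<Gamma>\<close> nonempty still has a vertex, so the right counit law would fail (\<open>\<Gamma>/\<Gamma>\<close> is a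
  set of isolated vertices, and has to be \<open>1\<close>); coassociativity would fail as well.
\<close>

definition tag_equiv :: "('v, 'e) tag \<Rightarrow> ('w, 'f) tag \<Rightarrow> bool" where
  "tag_equiv S T \<longleftrightarrow> tag_iso (subtag S (edges (fst S))) (subtag T (edges (fst T)))"

lemma tag_equiv_iff:
  "tag_equiv S T \<longleftrightarrow> (\<exists>f g. bij_betw f (\<Union>e\<in>edges (fst S). ends (fst S) e) (\<Union>e\<in>edges (fst T). ends (fst T) e)
     \<and> bij_betw g (edges (fst S)) (edges (fst T))
     \<and> (\<forall>e\<in>edges (fst S). ends (fst T) (g e) = f ` ends (fst S) e)
     \<and> (\<forall>e\<in>edges (fst S). \<forall>e'\<in>edges (fst S). (g e, g e') \<in> snd T \<longleftrightarrow> (e, e') \<in> snd S))"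
proof -
  have "(\<forall>e\<in>E. \<forall>e'\<in>E. (g e, g e') \<in> r \<inter> E' \<times> E' \<longleftrightarrow> (e, e') \<in> q \<inter> E \<times> E)
    = (\<forall>e\<in>E. \<forall>e'\<in>E. (g e, g e') \<in> r \<longleftrightarrow> (e, e') \<in> q)" if "bij_betw g E E'" for g E E' r q
    using bij_betw_apply[OF that] by simp
  note * = this
  show ?thesis
    unfolding tag_equiv_def tag_iso_def subtag_def subgraph_def fst_conv snd_conv graph.simps
    by (intro ex_cong1 conj_cong refl) (erule *)
qed

lemma tag_equivE:
  assumes "tag_equiv S T"
  obtains f g where "bij_betw f (\<Union>e\<in>edges (fst S). ends (fst S) e) (\<Union>e\<in>edges (fst T). ends (fst T) e)"
    and "bij_betw g (edges (fst S)) (edges (fst T))"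
    and "\<And>e. e \<in> edges (fst S) \<Longrightarrow> ends (fst T) (g e) = f ` ends (fst S) e"
    and "\<And>e e'. e \<in> edges (fst S) \<Longrightarrow> e' \<in> edges (fst S) \<Longrightarrow> (g e, g e') \<in> snd T \<longleftrightarrow> (e, e') \<in> snd S"
proof -
  from assms obtain f g where *: "bij_betw f (\<Union>e\<in>edges (fst S). ends (fst S) e) (\<Union>e\<in>edges (fst T). ends (fst T) e)"
     "bij_betw g (edges (fst S)) (edges (fst T))"
     "\<forall>e\<in>edges (fst S). ends (fst T) (g e) = f ` ends (fst S) e"
     "\<forall>e\<in>edges (fst S). \<forall>e'\<in>edges (fst S). (g e, g e') \<in> snd T \<longleftrightarrow> (e, e') \<in> snd S"
    unfolding tag_equiv_iff by (elim exE conjE) (rule that)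
  show thesis
    by (rule that[OF *(1,2)]) (use *(3,4) in simp_all)
qed

lemma tag_equiv_refl: "tag_equiv T T"
  unfolding tag_equiv_iff by (rule exI[of _ id], rule exI[of _ id]) auto

lemma tag_equiv_sym:
  assumes "tag_equiv S T"
  shows "tag_equiv T S"
proof -
  let ?VS = "\<Union>e\<in>edges (fst S). ends (fst S) e"
  let ?VT = "\<Union>e\<in>edges (fst T). ends (fst T) e"
  obtain f g where f: "bij_betw f ?VS ?VT" and g: "bij_betw g (edges (fst S)) (edges (fst T))"
    and e: "\<And>e. e \<in> edges (fst S) \<Longrightarrow> ends (fst T) (g e) = f ` ends (fst S) e"
    and o: "\<And>e e'. e \<in> edges (fst S) \<Longrightarrow> e' \<in> edges (fst S) \<Longrightarrow> (g e, g e') \<in> snd T \<longleftrightarrow> (e, e') \<in> snd S"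
    using assms by (rule tag_equivE) (rule that; simp)
  let ?f = "inv_into ?VS f" and ?g = "inv_into (edges (fst S)) g"
  have g': "?g y \<in> edges (fst S)" "g (?g y) = y" if "y \<in> edges (fst T)" for y
    using that g by (auto simp: bij_betw_def inv_into_into f_inv_into_f)
  have "ends (fst S) (?g y) = ?f ` ends (fst T) y" if y: "y \<in> edges (fst T)" for y
  proof -
    have "ends (fst T) y = f ` ends (fst S) (?g y)" using e[OF g'(1)[OF y]] g'(2)[OF y] by simp
    moreover have "ends (fst S) (?g y) \<subseteq> ?VS" using g'(1)[OF y] by blast
    ultimately show ?thesis using f by (simp add: bij_betw_def inv_into_image_cancel)
  qed
  moreover have "(?g y, ?g y') \<in> snd S \<longleftrightarrow> (y, y') \<in> snd T"
    if "y \<in> edges (fst T)" "y' \<in> edges (fst T)" for y y'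
    using o[OF g'(1) g'(1), OF that] g'(2) that by simp
  ultimately show ?thesis
    unfolding tag_equiv_iff using bij_betw_inv_into[OF f] bij_betw_inv_into[OF g] by blast
qed

lemma tag_equiv_trans:
  assumes "tag_equiv R S" "tag_equiv S T"
  shows "tag_equiv R T"
proof -
  obtain f g where f: "bij_betw f (\<Union>e\<in>edges (fst R). ends (fst R) e) (\<Union>e\<in>edges (fst S). ends (fst S) e)"
    and g: "bij_betw g (edges (fst R)) (edges (fst S))"
    and e: "\<And>e. e \<in> edges (fst R) \<Longrightarrow> ends (fst S) (g e) = f ` ends (fst R) e"
    and o: "\<And>e e'. e \<in> edges (fst R) \<Longrightarrow> e' \<in> edges (fst R) \<Longrightarrow> (g e, g e') \<in> snd S \<longleftrightarrow> (e, e') \<in> snd R"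
    using assms(1) by (rule tag_equivE) (rule that; simp)
  obtain f' g' where f': "bij_betw f' (\<Union>e\<in>edges (fst S). ends (fst S) e) (\<Union>e\<in>edges (fst T). ends (fst T) e)"
    and g': "bij_betw g' (edges (fst S)) (edges (fst T))"
    and e': "\<And>e. e \<in> edges (fst S) \<Longrightarrow> ends (fst T) (g' e) = f' ` ends (fst S) e"
    and o': "\<And>e e'. e \<in> edges (fst S) \<Longrightarrow> e' \<in> edges (fst S) \<Longrightarrow> (g' e, g' e') \<in> snd T \<longleftrightarrow> (e, e') \<in> snd S"
    using assms(2) by (rule tag_equivE) (rule that; simp)
  have gE: "g x \<in> edges (fst S)" if "x \<in> edges (fst R)" for x
    using g that by (auto simp: bij_betw_def)
  show ?thesis
    unfolding tag_equiv_iff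
    using bij_betw_trans[OF f f'] bij_betw_trans[OF g g'] gE
    by (intro exI[of _ "f' \<circ> f"] exI[of _ "g' \<circ> g"]) (auto simp: e e' o o' image_comp)
qed

lemma tag_iso_imp_tag_equiv:
  assumes "is_tag S" "tag_iso S T"
  shows "tag_equiv S T"
proof -
  obtain f g where f: "bij_betw f (verts (fst S)) (verts (fst T))"
    and g: "bij_betw g (edges (fst S)) (edges (fst T))"
    and e: "\<And>e. e \<in> edges (fst S) \<Longrightarrow> ends (fst T) (g e) = f ` ends (fst S) e"
    and o: "\<forall>e\<in>edges (fst S). \<forall>e'\<in>edges (fst S). (g e, g e') \<in> snd T \<longleftrightarrow> (e, e') \<in> snd S"
    using assms(2) unfolding tag_iso_def by (elim exE conjE) (rule that; simp)
  have "(\<Union>e\<in>edges (fst S). ends (fst S) e) \<subseteq> verts (fst S)"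
    using assms(1) by (auto simp: is_tag_def is_graph_def)
  then have "inj_on f (\<Union>e\<in>edges (fst S). ends (fst S) e)"
    using f by (auto simp: bij_betw_def intro: inj_on_subset)
  moreover have "f ` (\<Union>e\<in>edges (fst S). ends (fst S) e) = (\<Union>e\<in>edges (fst T). ends (fst T) e)"
    using g e by (simp add: bij_betw_def image_UN flip: g[unfolded bij_betw_def, THEN conjunct2])
  ultimately show ?thesis
    unfolding tag_equiv_iff using g e o
    by (intro exI[of _ f] exI[of _ g]) (simp add: bij_betw_def)
qed

text \<open>
  The classes are taken over graphs on natural numbers; a TAG of any type has such a copy
  (\<open>ex_nat_tag\<close>), and \<open>class_of\<close> is the class of that copy.
\<close>

quotient_type tag_class = "(nat, nat) tag" / partial: "\<lambda>S T. is_tag S \<and> is_tag T \<and> tag_equiv S T"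
proof (rule part_equivpI)
  show "\<exists>T :: (nat, nat) tag. is_tag T \<and> is_tag T \<and> tag_equiv T T"
    using is_tag_empty tag_equiv_refl by blast
next
  show "symp (\<lambda>S T :: (nat, nat) tag. is_tag S \<and> is_tag T \<and> tag_equiv S T)"
    by (rule sympI) (simp add: tag_equiv_sym)
next
  show "transp (\<lambda>S T :: (nat, nat) tag. is_tag S \<and> is_tag T \<and> tag_equiv S T)"
    by (rule transpI) (elim conjE, intro conjI, assumption, assumption, rule tag_equiv_trans)
qed

definition class_of :: "('v, 'e) tag \<Rightarrow> tag_class" where
  "class_of T = abs_tag_class (SOME S. is_tag S \<and> tag_equiv S T)"

lemma ex_nat_tag:
  assumes T: "is_tag T"
  obtains S :: "(nat, nat) tag" where "is_tag S" "tag_iso S T"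
proof -
  have fin: "finite (verts (fst T))" "finite (edges (fst T))"
    using T by (auto simp: is_tag_def is_graph_def)
  obtain f :: "'a \<Rightarrow> nat" where f: "inj_on f (verts (fst T))"
    using finite_imp_inj_to_nat_seg[OF fin(1)] by blast
  obtain h where h: "bij_betw h {0..<card (edges (fst T))} (edges (fst T))"
    using ex_bij_betw_nat_finite[OF fin(2)] by blast
  let ?E = "{0..<card (edges (fst T))}"
  have hE: "h n \<in> edges (fst T)" if "n \<in> ?E" for n using h that by (auto simp: bij_betw_def)
  have hi: "h a = h b \<longleftrightarrow> a = b" if "a \<in> ?E" "b \<in> ?E" for a b
    using h that by (auto simp: bij_betw_def inj_on_def)
  have sub: "ends (fst T) e \<subseteq> verts (fst T)" if "e \<in> edges (fst T)" for e
    using T that by (auto simp: is_tag_def is_graph_def)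
  have inj: "inj_on f (ends (fst T) e)" if "e \<in> edges (fst T)" for e
    using f sub[OF that] by (rule inj_on_subset)
  define S :: "(nat, nat) tag" where
    "S = (\<lparr>verts = f ` verts (fst T), edges = ?E, ends = (\<lambda>n. f ` ends (fst T) (h n))\<rparr>,
          {(a, b). a \<in> ?E \<and> b \<in> ?E \<and> (h a, h b) \<in> snd T})"
  have lo: "linear_order_on (edges (fst T)) (snd T)" using T by (simp add: is_tag_def)
  have "linear_order_on ?E (snd S)"
    using lo hE unfolding linear_order_on_def partial_order_on_def preorder_on_def
  proof (intro conjI; elim conjE)
    show "snd S \<subseteq> ?E \<times> ?E" by (auto simp: S_def)
    assume "trans (snd T)"
    then show "trans (snd S)" unfolding trans_def S_def by auto
  next
    assume "antisym (snd T)"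
    then show "antisym (snd S)" unfolding antisym_def S_def using hi by auto
  next
    assume "total_on (edges (fst T)) (snd T)"
    then show "total_on ?E (snd S)" unfolding total_on_def S_def using hi hE by auto
  next
    assume "refl_on (edges (fst T)) (snd T)"
    then show "refl_on ?E (snd S)" unfolding refl_on_def S_def using hE by auto
  qed
  moreover have "is_graph (fst S)"
  proof -
    have "card (f ` ends (fst T) (h n)) \<in> {1, 2}" if "n \<in> ?E" for n
      using T hE[OF that] card_image[OF inj[OF hE[OF that]]] by (simp add: is_tag_def is_graph_def)
    then show ?thesis using fin sub hE
      unfolding is_graph_def S_def by (auto simp del: atLeastLessThan_iff)
  qed
  ultimately have "is_tag S" by (simp add: is_tag_def S_def)
  moreover have "tag_iso S T"
    unfolding tag_iso_def
  proof (intro exI conjI)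
    show "bij_betw (inv_into (verts (fst T)) f) (verts (fst S)) (verts (fst T))"
      using bij_betw_inv_into[OF inj_on_imp_bij_betw[OF f]] by (simp add: S_def)
    show "bij_betw h (edges (fst S)) (edges (fst T))" using h by (simp add: S_def)
    show "\<forall>e\<in>edges (fst S). ends (fst T) (h e) = inv_into (verts (fst T)) f ` ends (fst S) e"
      using f hE sub by (simp add: S_def inv_into_image_cancel)
    show "\<forall>e\<in>edges (fst S). \<forall>e'\<in>edges (fst S). (h e, h e') \<in> snd T \<longleftrightarrow> (e, e') \<in> snd S"
      by (simp add: S_def)
  qed
  ultimately show thesis by (rule that)
qed

lemma class_of_nat_tag: "is_tag S \<Longrightarrow> class_of S = abs_tag_class S"
proof -
  assume S: "is_tag S"
  have *: "is_tag (SOME R :: (nat, nat) tag. is_tag R \<and> tag_equiv R S) \<and> tag_equiv (SOME R :: (nat, nat) tag. is_tag R \<and> tag_equiv R S) S"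
    by (rule someI[of _ S]) (simp add: S tag_equiv_refl)
  show ?thesis
    unfolding class_of_def
    by (rule Quotient3_rel_abs[OF Quotient3_tag_class]) (simp add: S *)
qed

lemma class_of_cong: "tag_equiv S T \<Longrightarrow> class_of S = class_of T"
proof -
  assume "tag_equiv S T"
  then have "tag_equiv R S \<longleftrightarrow> tag_equiv R T" for R :: "(nat, nat) tag"
    using tag_equiv_trans[of R S T] tag_equiv_trans[of R T S] tag_equiv_sym[of S T] by argo
  then show ?thesis by (simp add: class_of_def)
qed

lemma class_of_eq_iff:
  assumes "is_tag S" "is_tag T"
  shows "class_of S = class_of T \<longleftrightarrow> tag_equiv S T"
proof
  assume eq: "class_of S = class_of T"
  obtain S' :: "(nat, nat) tag" where S': "is_tag S'" "tag_equiv S' S"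
    by (rule ex_nat_tag[OF assms(1)]) (rule that, assumption, rule tag_iso_imp_tag_equiv)
  obtain T' :: "(nat, nat) tag" where T': "is_tag T'" "tag_equiv T' T"
    by (rule ex_nat_tag[OF assms(2)]) (rule that, assumption, rule tag_iso_imp_tag_equiv)
  have "abs_tag_class S' = abs_tag_class T'"
    using eq class_of_cong[OF S'(2)] class_of_cong[OF T'(2)] S'(1) T'(1)
    by (simp add: class_of_nat_tag)
  then have "tag_equiv S' T'"
    using Quotient3_rel[OF Quotient3_tag_class, of S' T'] S'(1) T'(1) tag_equiv_refl[of S'] tag_equiv_refl[of T']
    by simp
  then have "tag_equiv S T'" using tag_equiv_trans[OF tag_equiv_sym[OF S'(2)]] by blast
  then show "tag_equiv S T" using T'(2) by (rule tag_equiv_trans)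
qed (rule class_of_cong)

lemma disj_tag_cong:
  assumes "tag_equiv S S'" "tag_equiv T T'"
  shows "tag_equiv (disj_tag S T) (disj_tag S' T')"
proof -
  obtain f g where f: "bij_betw f (\<Union>e\<in>edges (fst S). ends (fst S) e) (\<Union>e\<in>edges (fst S'). ends (fst S') e)"
    and g: "bij_betw g (edges (fst S)) (edges (fst S'))"
    and e: "\<And>e. e \<in> edges (fst S) \<Longrightarrow> ends (fst S') (g e) = f ` ends (fst S) e"
    and o: "\<And>e e'. e \<in> edges (fst S) \<Longrightarrow> e' \<in> edges (fst S) \<Longrightarrow> (g e, g e') \<in> snd S' \<longleftrightarrow> (e, e') \<in> snd S"
    using assms(1) by (rule tag_equivE) (rule that; simp)
  obtain f' g' where f': "bij_betw f' (\<Union>e\<in>edges (fst T). ends (fst T) e) (\<Union>e\<in>edges (fst T'). ends (fst T') e)"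
    and g': "bij_betw g' (edges (fst T)) (edges (fst T'))"
    and e': "\<And>e. e \<in> edges (fst T) \<Longrightarrow> ends (fst T') (g' e) = f' ` ends (fst T) e"
    and o': "\<And>e e'. e \<in> edges (fst T) \<Longrightarrow> e' \<in> edges (fst T) \<Longrightarrow> (g' e, g' e') \<in> snd T' \<longleftrightarrow> (e, e') \<in> snd T"
    using assms(2) by (rule tag_equivE) (rule that; simp)
  have gE: "g x \<in> edges (fst S')" if "x \<in> edges (fst S)" for x
    using g that by (auto simp: bij_betw_def)
  have gE': "g' x \<in> edges (fst T')" if "x \<in> edges (fst T)" for x
    using g' that by (auto simp: bij_betw_def)
  have U: "(\<Union>e\<in>edges (fst (disj_tag A B)). ends (fst (disj_tag A B)) e)
    = (\<Union>e\<in>edges (fst A). ends (fst A) e) <+> (\<Union>e\<in>edges (fst B). ends (fst B) e)"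
    for A :: "('x, 'y) tag" and B :: "('z, 'w) tag"
    by (auto simp: disj_tag_def disj_graph_def)
  have b: "bij_betw (map_sum p q) (A <+> B) (A' <+> B')"
    if "bij_betw p A A'" "bij_betw q B B'"
    for p :: "'x \<Rightarrow> 'y" and q :: "'z \<Rightarrow> 'w" and A B A' B'
  proof -
    have "map_sum p q ` (A <+> B) = p ` A <+> q ` B" by force
    moreover have "inj_on (map_sum p q) (A <+> B)"
      using that unfolding bij_betw_def by (intro inj_onI) (auto dest: inj_onD)
    ultimately show ?thesis using that by (simp add: bij_betw_def)
  qed
  have m: "(x, y) \<in> snd (disj_tag A B) \<longleftrightarrow>
      (case (x, y) of (Inl a, Inl b) \<Rightarrow> (a, b) \<in> snd A | (Inr a, Inr b) \<Rightarrow> (a, b) \<in> snd B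
       | (Inl a, Inr b) \<Rightarrow> a \<in> edges (fst A) \<and> b \<in> edges (fst B) | _ \<Rightarrow> False)"
    for x y and A :: "('x, 'y) tag" and B :: "('z, 'w) tag"
    by (cases x; cases y) (auto simp: disj_tag_def map_prod_def image_iff
          split: prod.splits intro: bexI)
  have E: "edges (fst (disj_tag A B)) = edges (fst A) <+> edges (fst B)"
    for A :: "('x, 'y) tag" and B :: "('z, 'w) tag"
    by (simp add: disj_tag_def disj_graph_def)
  show ?thesis
    unfolding tag_equiv_iff U unfolding E m
  proof (intro exI conjI)
    show "bij_betw (map_sum f f') ((\<Union>e\<in>edges (fst S). ends (fst S) e) <+> (\<Union>e\<in>edges (fst T). ends (fst T) e))
      ((\<Union>e\<in>edges (fst S'). ends (fst S') e) <+> (\<Union>e\<in>edges (fst T'). ends (fst T') e))"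
      using f f' by (rule b)
    show "bij_betw (map_sum g g') (edges (fst S) <+> edges (fst T)) (edges (fst S') <+> edges (fst T'))"
      using g g' by (rule b)
    show "\<forall>e\<in>edges (fst S) <+> edges (fst T). ends (fst (disj_tag S' T')) (map_sum g g' e)
      = map_sum f f' ` ends (fst (disj_tag S T)) e"
      by (auto simp: disj_tag_def disj_graph_def e e' image_image)
  qed (auto simp: o o' gE gE')
qed

lemma component_image:
  assumes f: "bij_betw f (\<Union>e\<in>edges G. ends G e) V'" and A: "A \<subseteq> edges G"
    and e: "\<And>e. e \<in> A \<Longrightarrow> ends G' (g e) = f ` ends G e"
    and v: "v \<in> (\<Union>e\<in>edges G. ends G e)"
  shows "component (subgraph G' (g ` A)) (f v) = f ` component (subgraph G A) v"
    and "component (subgraph G A) v \<subseteq> (\<Union>e\<in>edges G. ends G e)"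
proof -
  let ?r = "adjacency (subgraph G A)" and ?s = "adjacency (subgraph G' (g ` A))"
  let ?V = "\<Union>e\<in>edges G. ends G e"
  have r: "(x, y) \<in> ?r \<longleftrightarrow> (\<exists>e\<in>A. ends G e = {x, y})" for x y
    by (simp add: adjacency_def subgraph_def)
  have s: "(x, y) \<in> ?s \<longleftrightarrow> (\<exists>e\<in>A. f ` ends G e = {x, y})" for x y
    using e by (auto simp: adjacency_def subgraph_def)
  have inj: "inj_on f ?V" using f by (simp add: bij_betw_def)
  show sub: "component (subgraph G A) v \<subseteq> ?V"
  proof
    fix w assume "w \<in> component (subgraph G A) v"
    then have "(v, w) \<in> ?r\<^sup>*" by (simp add: component_def)
    then show "w \<in> ?V"
    proof induction
      case base
      show ?case by (rule v)
    next
      case (step y z)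
      then obtain d where "d \<in> A" "ends G d = {y, z}" using r by auto
      then show ?case using A by (intro UN_I[of d]) auto
    qed
  qed
  have 1: "(f v, f w) \<in> ?s\<^sup>*" if "(v, w) \<in> ?r\<^sup>*" for w
    using that
  proof induction
    case (step y z)
    then obtain d where "d \<in> A" "ends G d = {y, z}" using r by auto
    then have "(f y, f z) \<in> ?s" unfolding s by (intro bexI[of _ d]) auto
    with step(3) show ?case by (rule rtrancl_into_rtrancl)
  qed simp
  have 2: "\<exists>w. x = f w \<and> (v, w) \<in> ?r\<^sup>*" if "(f v, x) \<in> ?s\<^sup>*" for x
    using that
  proof induction
    case base
    then show ?case by blast
  next
    case (step y z)
    then obtain w where w: "y = f w" "(v, w) \<in> ?r\<^sup>*" by blast
    then have wV: "w \<in> ?V" using sub by (auto simp: component_def)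
    obtain d where d: "d \<in> A" "f ` ends G d = {f w, z}" using step(2) s w(1) by blast
    have dV: "ends G d \<subseteq> ?V" using d A by blast
    obtain u where u: "u \<in> ends G d" "z = f u" using d(2) by blast
    have "f ` ends G d = f ` {w, u}" using d u by simp
    then have "ends G d = {w, u}"
      using inj_on_image_eq_iff[OF inj dV, of "{w, u}"] wV u dV by blast
    then have "(w, u) \<in> ?r" using r d(1) by blast
    with w(2) have "(v, u) \<in> ?r\<^sup>*" by (rule rtrancl_into_rtrancl)
    with u(2) show ?case by blast
  qed
  show "component (subgraph G' (g ` A)) (f v) = f ` component (subgraph G A) v"
    using 1 2 by (auto simp: component_def)
qed

lemma subtag_shrink_cong:
  fixes S :: "('v, 'e) tag" and T :: "('w, 'f) tag"
  assumes "tag_equiv S T"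
  obtains g where "bij_betw g (edges (fst S)) (edges (fst T))"
    "\<And>A. A \<subseteq> edges (fst S) \<Longrightarrow> tag_equiv (subtag S A) (subtag T (g ` A))"
    "\<And>A. A \<subseteq> edges (fst S) \<Longrightarrow> tag_equiv (shrink_tag S A) (shrink_tag T (g ` A))"
proof -
  let ?VS = "\<Union>e\<in>edges (fst S). ends (fst S) e"
  let ?VT = "\<Union>e\<in>edges (fst T). ends (fst T) e"
  obtain f g where f: "bij_betw f ?VS ?VT" and g: "bij_betw g (edges (fst S)) (edges (fst T))"
    and e: "\<And>e. e \<in> edges (fst S) \<Longrightarrow> ends (fst T) (g e) = f ` ends (fst S) e"
    and o: "\<And>e e'. e \<in> edges (fst S) \<Longrightarrow> e' \<in> edges (fst S) \<Longrightarrow> (g e, g e') \<in> snd T \<longleftrightarrow> (e, e') \<in> snd S"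
    using assms by (rule tag_equivE) (rule that; simp)
  have inj: "inj_on f ?VS" and ginj: "inj_on g (edges (fst S))"
    using f g by (auto simp: bij_betw_def)
  show thesis
  proof (rule that[OF g])
    fix A assume A: "A \<subseteq> edges (fst S)"
    show "tag_equiv (subtag S A) (subtag T (g ` A))"
      unfolding tag_equiv_iff
    proof (intro exI conjI)
      show "bij_betw f (\<Union>e\<in>edges (fst (subtag S A)). ends (fst (subtag S A)) e)
         (\<Union>e\<in>edges (fst (subtag T (g ` A))). ends (fst (subtag T (g ` A))) e)"
      proof -
        have "(\<Union>e\<in>A. ends (fst S) e) \<subseteq> ?VS" using A by blast
        then have "inj_on f (\<Union>e\<in>A. ends (fst S) e)" using inj by (rule inj_on_subset[rotated])
        moreover have "f ` (\<Union>e\<in>A. ends (fst S) e) = (\<Union>e\<in>g ` A. ends (fst T) e)"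
          using e A by (auto simp: image_UN subset_eq)
        ultimately show ?thesis by (simp add: subtag_def subgraph_def bij_betw_def)
      qed
      show "bij_betw g (edges (fst (subtag S A))) (edges (fst (subtag T (g ` A))))"
        using ginj A by (auto simp: subtag_def subgraph_def bij_betw_def intro: inj_on_subset)
    qed (use e o A in \<open>auto simp: subtag_def subgraph_def subset_eq\<close>)
    let ?c = "component (subgraph (fst S) A)" and ?d = "component (subgraph (fst T) (g ` A))"
    have c: "?d (f v) = f ` ?c v" "?c v \<subseteq> ?VS" if "v \<in> ?VS" for v
      by (rule component_image[OF f A e that], use A in blast)+
    have gA: "g ` (edges (fst S) - A) = edges (fst T) - g ` A"
      using g A inj_on_image_set_diff[OF ginj, of "edges (fst S)" A] by (auto simp: bij_betw_def)
    have end_image: "?d ` ends (fst T) (g x) = (`) f ` ?c ` ends (fst S) x" if "x \<in> edges (fst S)" for x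
    proof -
      have "?d (f v) = f ` ?c v" if "v \<in> ends (fst S) x" for v
        using c(1)[of v] that \<open>x \<in> edges (fst S)\<close> by blast
      then show ?thesis using e[OF that] by (auto simp: image_image)
    qed
    show "tag_equiv (shrink_tag S A) (shrink_tag T (g ` A))"
      unfolding tag_equiv_iff
    proof (intro exI conjI)
      let ?U = "\<Union>e\<in>edges (fst S) - A. ?c ` ends (fst S) e"
      let ?U' = "\<Union>e\<in>edges (fst T) - g ` A. ?d ` ends (fst T) e"
      have "inj_on ((`) f) ?U"
      proof (rule inj_on_subset)
        show "inj_on ((`) f) (Pow ?VS)" using inj by (rule inj_on_image_Pow)
        show "?U \<subseteq> Pow ?VS" using c(2) by blast
      qed
      moreover have "(`) f ` ?U = ?U'"
        unfolding gA[symmetric] using end_image by (simp add: image_UN)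
      ultimately show "bij_betw ((`) f) (\<Union>e\<in>edges (fst (shrink_tag S A)). ends (fst (shrink_tag S A)) e)
         (\<Union>e\<in>edges (fst (shrink_tag T (g ` A))). ends (fst (shrink_tag T (g ` A))) e)"
        by (simp add: shrink_tag_def shrink_graph_def bij_betw_def)
      show "bij_betw g (edges (fst (shrink_tag S A))) (edges (fst (shrink_tag T (g ` A))))"
        using ginj gA by (auto simp: shrink_tag_def shrink_graph_def bij_betw_def intro: inj_on_subset)
      show "\<forall>e\<in>edges (fst (shrink_tag S A)). ends (fst (shrink_tag T (g ` A))) (g e)
         = (`) f ` ends (fst (shrink_tag S A)) e"
        using end_image by (simp add: shrink_tag_def shrink_graph_def)
      show "\<forall>e\<in>edges (fst (shrink_tag S A)). \<forall>e'\<in>edges (fst (shrink_tag S A)).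
        (g e, g e') \<in> snd (shrink_tag T (g ` A)) \<longleftrightarrow> (e, e') \<in> snd (shrink_tag S A)"
        using gA o by (auto simp: shrink_tag_def shrink_graph_def)
    qed
  qed
qed


section \<open>Free vector spaces and their tensor products\<close>

text \<open>
  The free vector space on \<open>'a\<close> is \<open>'a \<Rightarrow>\<^sub>0 'k\<close>. The tensor product of \<open>'a \<Rightarrow>\<^sub>0 'k\<close> and
  \<open>'b \<Rightarrow>\<^sub>0 'k\<close> is \<open>'a \<times> 'b \<Rightarrow>\<^sub>0 'k\<close>, with the bilinear map \<open>tensor\<close>; its universal property is
  proved below.
\<close>

definition basis_vec :: "'a \<Rightarrow> 'a \<Rightarrow>\<^sub>0 'k::field" where
  "basis_vec a = Poly_Mapping.single a 1"

definition vscale :: "'k::field \<Rightarrow> ('a \<Rightarrow>\<^sub>0 'k) \<Rightarrow> ('a \<Rightarrow>\<^sub>0 'k)" where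
  "vscale c p = Poly_Mapping.map ((*) c) p"

definition lin_ext :: "('k \<Rightarrow> 'v \<Rightarrow> 'v) \<Rightarrow> ('a \<Rightarrow> 'v) \<Rightarrow> ('a \<Rightarrow>\<^sub>0 'k::field) \<Rightarrow> 'v::ab_group_add" where
  "lin_ext s f p = (\<Sum>a\<in>Poly_Mapping.keys p. s (Poly_Mapping.lookup p a) (f a))"

definition bilin :: "('k \<Rightarrow> 'v \<Rightarrow> 'v) \<Rightarrow> (('a \<Rightarrow>\<^sub>0 'k::field) \<Rightarrow> ('b \<Rightarrow>\<^sub>0 'k) \<Rightarrow> 'v::ab_group_add) \<Rightarrow> bool" where
  "bilin s B \<longleftrightarrow> (\<forall>x. Vector_Spaces.linear vscale s (B x)) \<and> (\<forall>y. Vector_Spaces.linear vscale s (\<lambda>x. B x y))"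

definition tensor :: "('a \<Rightarrow>\<^sub>0 'k::field) \<Rightarrow> ('b \<Rightarrow>\<^sub>0 'k) \<Rightarrow> ('a \<times> 'b \<Rightarrow>\<^sub>0 'k)" (infixr \<open>\<otimes>\<close> 75) where
  "x \<otimes> y = lin_ext vscale (\<lambda>a. lin_ext vscale (\<lambda>b. basis_vec (a, b)) y) x"

text \<open>The linear map on the tensor product that is induced by a bilinear map.\<close>

definition tensor_lift ::
  "('k \<Rightarrow> 'v \<Rightarrow> 'v) \<Rightarrow> (('a \<Rightarrow>\<^sub>0 'k::field) \<Rightarrow> ('b \<Rightarrow>\<^sub>0 'k) \<Rightarrow> 'v::ab_group_add) \<Rightarrow> ('a \<times> 'b \<Rightarrow>\<^sub>0 'k) \<Rightarrow> 'v" where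
  "tensor_lift s B = lin_ext s (\<lambda>(a, b). B (basis_vec a) (basis_vec b))"

definition tensor_map ::
  "(('a \<Rightarrow>\<^sub>0 'k::field) \<Rightarrow> ('c \<Rightarrow>\<^sub>0 'k)) \<Rightarrow> (('b \<Rightarrow>\<^sub>0 'k) \<Rightarrow> ('d \<Rightarrow>\<^sub>0 'k)) \<Rightarrow> ('a \<times> 'b \<Rightarrow>\<^sub>0 'k) \<Rightarrow> ('c \<times> 'd \<Rightarrow>\<^sub>0 'k)" where
  "tensor_map f g = tensor_lift vscale (\<lambda>x y. f x \<otimes> g y)"

definition tensor_assoc :: "(('a \<times> 'b) \<times> 'c \<Rightarrow>\<^sub>0 'k::field) \<Rightarrow> ('a \<times> 'b \<times> 'c \<Rightarrow>\<^sub>0 'k)" where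
  "tensor_assoc = lin_ext vscale (\<lambda>((a, b), c). basis_vec (a, b, c))"

text \<open>The product of the algebra \<open>A \<otimes> A\<close>, which satisfies \<open>(x \<otimes> y) (x' \<otimes> y') = x x' \<otimes> y y'\<close>.\<close>

definition tensor_mult ::
  "(('a \<Rightarrow>\<^sub>0 'k::field) \<Rightarrow> ('a \<Rightarrow>\<^sub>0 'k) \<Rightarrow> ('a \<Rightarrow>\<^sub>0 'k)) \<Rightarrow> ('a \<times> 'a \<Rightarrow>\<^sub>0 'k) \<Rightarrow> ('a \<times> 'a \<Rightarrow>\<^sub>0 'k) \<Rightarrow> ('a \<times> 'a \<Rightarrow>\<^sub>0 'k)" where
  "tensor_mult m p q = tensor_lift vscale (\<lambda>x y. tensor_lift vscale (\<lambda>x' y'. m x x' \<otimes> m y y') q) p"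

lemma lookup_vscale [simp]: "Poly_Mapping.lookup (vscale c p) a = c * Poly_Mapping.lookup p a"
  by (simp add: vscale_def Poly_Mapping.map.rep_eq when_def)

lemma vector_space_vscale: "vector_space (vscale :: 'k::field \<Rightarrow> ('a \<Rightarrow>\<^sub>0 'k) \<Rightarrow> _)"
  by unfold_locales (auto intro!: poly_mapping_eqI simp: lookup_add algebra_simps)

lemma lin_ext_superset:
  assumes "vector_space s" "finite K" "Poly_Mapping.keys p \<subseteq> K"
  shows "lin_ext s f p = (\<Sum>a\<in>K. s (Poly_Mapping.lookup p a) (f a))"
proof -
  interpret vector_space s by fact
  show ?thesis unfolding lin_ext_def
    by (rule sum.mono_neutral_left) (use assms in \<open>auto simp: in_keys_iff\<close>)
qed

lemma linear_lin_ext: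
  assumes "vector_space s"
  shows "Vector_Spaces.linear vscale s (lin_ext s f)"
proof -
  interpret vector_space s by fact
  have "lin_ext s f (p + q) = lin_ext s f p + lin_ext s f q" for p q
  proof -
    let ?K = "Poly_Mapping.keys p \<union> Poly_Mapping.keys q"
    have "Poly_Mapping.keys (p + q) \<subseteq> ?K" by (rule keys_add)
    then show ?thesis
      by (simp add: lin_ext_superset[OF assms, of ?K] lookup_add scale_left_distrib sum.distrib)
  qed
  moreover have "lin_ext s f (vscale c p) = s c (lin_ext s f p)" for c p
  proof -
    have "Poly_Mapping.keys (vscale c p) \<subseteq> Poly_Mapping.keys p" by (auto simp: in_keys_iff)
    then show ?thesis
      by (simp add: lin_ext_superset[OF assms, of "Poly_Mapping.keys p"] scale_sum_right)
  qed
  ultimately show ?thesis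
    using assms vector_space_vscale
    by (auto simp: Vector_Spaces.linear_iff)
qed

lemma lin_ext_basis_vec: "vector_space s \<Longrightarrow> lin_ext s f (basis_vec a) = f a"
  by (simp add: lin_ext_def basis_vec_def vector_space.vector_space_assms(4))

lemma linear_eq_on_basis:
  assumes f: "Vector_Spaces.linear vscale s f" and g: "Vector_Spaces.linear vscale s g"
    and eq: "\<And>a. f (basis_vec a) = g (basis_vec a)"
  shows "f p = g p"
proof -
  have p: "p = (\<Sum>a\<in>Poly_Mapping.keys p. vscale (Poly_Mapping.lookup p a) (basis_vec a))"
    by (rule poly_mapping_eqI)
      (auto simp: lookup_sum basis_vec_def lookup_single when_def in_keys_iff if_distrib cong: if_cong)
  interpret f: Vector_Spaces.linear vscale s f by fact
  interpret g: Vector_Spaces.linear vscale s g by fact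
  show ?thesis
    by (subst (1 2) p) (simp add: f.sum g.sum f.scale g.scale eq)
qed

lemma tensor_basis_vec: "basis_vec a \<otimes> basis_vec b = basis_vec (a, b)"
  by (simp add: tensor_def lin_ext_basis_vec vector_space_vscale)

lemma lookup_tensor:
  "Poly_Mapping.lookup (x \<otimes> y) (a, b) = Poly_Mapping.lookup x a * Poly_Mapping.lookup y b"
proof -
  have "Poly_Mapping.lookup (x \<otimes> y) (a, b) = (\<Sum>i\<in>Poly_Mapping.keys x. \<Sum>j\<in>Poly_Mapping.keys y.
      if j = b \<and> i = a then Poly_Mapping.lookup x i * Poly_Mapping.lookup y j else 0)"
    by (simp add: tensor_def lin_ext_def basis_vec_def lookup_sum lookup_single when_def
        sum_distrib_left if_distrib cong: if_cong) (intro sum.cong refl; auto)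
  also have "\<dots> = (\<Sum>i\<in>Poly_Mapping.keys x. if i = a then \<Sum>j\<in>Poly_Mapping.keys y.
      if j = b then Poly_Mapping.lookup x i * Poly_Mapping.lookup y j else 0 else 0)"
    by (intro sum.cong refl) auto
  finally show ?thesis by (auto simp: in_keys_iff)
qed

lemma bilin_tensor: "bilin vscale (\<otimes>)"
  unfolding bilin_def Vector_Spaces.linear_iff
  by (auto intro!: vector_space_vscale poly_mapping_eqI simp: lookup_tensor lookup_add algebra_simps)

lemma linear_tensor:
  "Vector_Spaces.linear vscale vscale (\<lambda>y. x \<otimes> y)"
  "Vector_Spaces.linear vscale vscale (\<lambda>x. x \<otimes> y)"
  using bilin_tensor unfolding bilin_def by blast+

lemma tensor_lift_tensor:
  assumes "vector_space s" "bilin s B"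
  shows "tensor_lift s B (x \<otimes> y) = B x y"
proof -
  have L: "Vector_Spaces.linear vscale s (tensor_lift s B)"
    unfolding tensor_lift_def by (rule linear_lin_ext) fact
  have 1: "tensor_lift s B (basis_vec a \<otimes> y) = B (basis_vec a) y" for a y
  proof (rule linear_eq_on_basis)
    show "Vector_Spaces.linear vscale s (\<lambda>y. tensor_lift s B (basis_vec a \<otimes> y))"
      using Vector_Spaces.linear_compose[OF linear_tensor(1) L] by (simp add: o_def)
    show "Vector_Spaces.linear vscale s (B (basis_vec a))" using assms(2) by (simp add: bilin_def)
  qed (simp add: tensor_basis_vec tensor_lift_def lin_ext_basis_vec assms)
  show ?thesis
  proof (rule linear_eq_on_basis[of s "\<lambda>x. tensor_lift s B (x \<otimes> y)"])
    show "Vector_Spaces.linear vscale s (\<lambda>x. tensor_lift s B (x \<otimes> y))"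
      using Vector_Spaces.linear_compose[OF linear_tensor(2) L] by (simp add: o_def)
    show "Vector_Spaces.linear vscale s (\<lambda>x. B x y)" using assms(2) by (simp add: bilin_def)
  qed (rule 1)
qed

theorem tensor_universal:
  assumes "vector_space s" "bilin s B"
  shows "\<exists>!L. Vector_Spaces.linear vscale s L \<and> (\<forall>x y. L (x \<otimes> y) = B x y)"
proof (rule ex1I[of _ "tensor_lift s B"])
  show "Vector_Spaces.linear vscale s (tensor_lift s B) \<and> (\<forall>x y. tensor_lift s B (x \<otimes> y) = B x y)"
    using tensor_lift_tensor[OF assms] linear_lin_ext[OF assms(1)] by (simp add: tensor_lift_def)
  fix L assume L: "Vector_Spaces.linear vscale s L \<and> (\<forall>x y. L (x \<otimes> y) = B x y)"
  show "L = tensor_lift s B"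
  proof
    fix p show "L p = tensor_lift s B p"
    proof (rule linear_eq_on_basis)
      show "Vector_Spaces.linear vscale s (tensor_lift s B)"
        unfolding tensor_lift_def by (rule linear_lin_ext) (rule assms)
      show "L (basis_vec ab) = tensor_lift s B (basis_vec ab)" for ab
        using L tensor_lift_tensor[OF assms] by (cases ab) (metis tensor_basis_vec)
    qed (use L in blast)
  qed
qed


section \<open>Bialgebras\<close>

locale unital_assoc_algebra =
  fixes m :: "('a \<Rightarrow>\<^sub>0 'k::field) \<Rightarrow> ('a \<Rightarrow>\<^sub>0 'k) \<Rightarrow> ('a \<Rightarrow>\<^sub>0 'k)" and one :: "'a \<Rightarrow>\<^sub>0 'k"
  assumes m_bilin: "bilin vscale m"
    and m_assoc: "m (m x y) z = m x (m y z)"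
    and m_one_left: "m one x = x"
    and m_one_right: "m x one = x"

locale counital_coassoc_coalgebra =
  fixes \<Delta> :: "('a \<Rightarrow>\<^sub>0 'k::field) \<Rightarrow> ('a \<times> 'a \<Rightarrow>\<^sub>0 'k)" and \<epsilon> :: "('a \<Rightarrow>\<^sub>0 'k) \<Rightarrow> 'k"
  assumes comult_linear: "Vector_Spaces.linear vscale vscale \<Delta>"
    and counit_linear: "Vector_Spaces.linear vscale (*) \<epsilon>"
    and coassoc: "tensor_assoc (tensor_map \<Delta> id (\<Delta> x)) = tensor_map id \<Delta> (\<Delta> x)"
    and counit_left: "tensor_lift vscale (\<lambda>y z. vscale (\<epsilon> y) z) (\<Delta> x) = x"
    and counit_right: "tensor_lift vscale (\<lambda>y z. vscale (\<epsilon> z) y) (\<Delta> x) = x"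

locale bialgebra = unital_assoc_algebra m one + counital_coassoc_coalgebra \<Delta> \<epsilon>
  for m :: "('a \<Rightarrow>\<^sub>0 'k::field) \<Rightarrow> ('a \<Rightarrow>\<^sub>0 'k) \<Rightarrow> ('a \<Rightarrow>\<^sub>0 'k)" and one :: "'a \<Rightarrow>\<^sub>0 'k"
    and \<Delta> :: "('a \<Rightarrow>\<^sub>0 'k) \<Rightarrow> ('a \<times> 'a \<Rightarrow>\<^sub>0 'k)" and \<epsilon> :: "('a \<Rightarrow>\<^sub>0 'k) \<Rightarrow> 'k" +
  assumes comult_mult: "\<Delta> (m x y) = tensor_mult m (\<Delta> x) (\<Delta> y)"
    and comult_one: "\<Delta> one = one \<otimes> one"
    and counit_mult: "\<epsilon> (m x y) = \<epsilon> x * \<epsilon> y"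
    and counit_one: "\<epsilon> one = 1"


section \<open>The structure maps on TAGs\<close>

type_synonym 'k tag_space = "tag_class \<Rightarrow>\<^sub>0 'k"

lift_definition tag_class_disj :: "tag_class \<Rightarrow> tag_class \<Rightarrow> tag_class"
  is "\<lambda>S T. class_of (disj_tag S T)"
  by (auto intro!: class_of_cong disj_tag_cong)

lemma comult_sum_cong:
  assumes "tag_equiv S T"
  shows "(\<Sum>A\<in>Pow (edges (fst S)).
        basis_vec (class_of (subtag S A)) \<otimes> basis_vec (class_of (shrink_tag S A)))
    = (\<Sum>A\<in>Pow (edges (fst T)).
        basis_vec (class_of (subtag T A)) \<otimes> (basis_vec (class_of (shrink_tag T A)) :: tag_class \<Rightarrow>\<^sub>0 'k::field))"
proof -
  obtain g where g: "bij_betw g (edges (fst S)) (edges (fst T))"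
    "\<And>A. A \<subseteq> edges (fst S) \<Longrightarrow> tag_equiv (subtag S A) (subtag T (g ` A))"
    "\<And>A. A \<subseteq> edges (fst S) \<Longrightarrow> tag_equiv (shrink_tag S A) (shrink_tag T (g ` A))"
    by (rule subtag_shrink_cong[OF assms]) (rule that; simp)
  have "bij_betw ((`) g) (Pow (edges (fst S))) (Pow (edges (fst T)))"
    using g(1) by (rule bij_betw_Pow)
  from sum.reindex_bij_betw[OF this, of "\<lambda>A. basis_vec (class_of (subtag T A)) \<otimes>
      (basis_vec (class_of (shrink_tag T A)) :: tag_class \<Rightarrow>\<^sub>0 'k)", symmetric]
  show ?thesis
    using class_of_cong[OF g(2)] class_of_cong[OF g(3)] by simp
qed

lift_definition tag_class_comult :: "tag_class \<Rightarrow> (tag_class \<times> tag_class \<Rightarrow>\<^sub>0 'k::field)"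
  is "\<lambda>T. \<Sum>A\<in>Pow (edges (fst T)).
        basis_vec (class_of (subtag T A)) \<otimes> basis_vec (class_of (shrink_tag T A))"
  by (elim conjE) (rule comult_sum_cong)

definition tag_one :: "'k::field tag_space" where
  "tag_one = basis_vec (class_of (empty_tag :: (nat, nat) tag))"

definition tag_mult :: "'k::field tag_space \<Rightarrow> 'k tag_space \<Rightarrow> 'k tag_space" where
  "tag_mult x y = lin_ext vscale (\<lambda>(X, Y). basis_vec (tag_class_disj X Y)) (x \<otimes> y)"

definition tag_comult :: "'k::field tag_space \<Rightarrow> (tag_class \<times> tag_class \<Rightarrow>\<^sub>0 'k)" where
  "tag_comult = lin_ext vscale tag_class_comult"

definition tag_counit :: "'k::field tag_space \<Rightarrow> 'k" where
  "tag_counit = lin_ext (*) (\<lambda>X. if X = class_of (empty_tag :: (nat, nat) tag) then 1 else 0)"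

lemma tag_mult_class_of:
  assumes "is_tag S" "is_tag T"
  shows "tag_mult (basis_vec (class_of S)) (basis_vec (class_of T))
    = (basis_vec (class_of (disj_tag S T)) :: 'k::field tag_space)"
proof -
  obtain S' :: "(nat, nat) tag" where S': "is_tag S'" "tag_equiv S' S"
    by (rule ex_nat_tag[OF assms(1)]) (rule that, assumption, rule tag_iso_imp_tag_equiv)
  obtain T' :: "(nat, nat) tag" where T': "is_tag T'" "tag_equiv T' T"
    by (rule ex_nat_tag[OF assms(2)]) (rule that, assumption, rule tag_iso_imp_tag_equiv)
  have "class_of S = abs_tag_class S'" "class_of T = abs_tag_class T'"
    using class_of_cong[OF S'(2)] class_of_cong[OF T'(2)] class_of_nat_tag S'(1) T'(1) by metis+
  moreover have "tag_class_disj (abs_tag_class S') (abs_tag_class T') = class_of (disj_tag S' T')"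
    by (rule tag_class_disj.abs_eq) (simp_all add: eq_onp_def S' T' tag_equiv_refl)
  moreover have "class_of (disj_tag S' T') = class_of (disj_tag S T)"
    by (rule class_of_cong, rule disj_tag_cong) (rule S' T')+
  ultimately show ?thesis
    by (simp add: tag_mult_def tensor_basis_vec lin_ext_basis_vec vector_space_vscale)
qed

lemma tag_comult_class_of:
  assumes "is_tag T"
  shows "tag_comult (basis_vec (class_of T) :: 'k::field tag_space)
    = (\<Sum>A\<in>Pow (edges (fst T)). basis_vec (class_of (subtag T A)) \<otimes> basis_vec (class_of (shrink_tag T A)))"
proof -
  obtain T' :: "(nat, nat) tag" where T': "is_tag T'" "tag_equiv T' T"
    by (rule ex_nat_tag[OF assms]) (rule that, assumption, rule tag_iso_imp_tag_equiv)
  have "class_of T = abs_tag_class T'"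
    using class_of_cong[OF T'(2)] class_of_nat_tag T'(1) by metis
  moreover have "(tag_class_comult (abs_tag_class T') :: _ \<Rightarrow>\<^sub>0 'k) = (\<Sum>A\<in>Pow (edges (fst T')).
      basis_vec (class_of (subtag T' A)) \<otimes> basis_vec (class_of (shrink_tag T' A)))"
    by (rule tag_class_comult.abs_eq) (simp add: eq_onp_def T' tag_equiv_refl)
  ultimately show ?thesis
    by (simp add: tag_comult_def lin_ext_basis_vec vector_space_vscale comult_sum_cong[OF T'(2)])
qed

lemma tag_counit_class_of:
  assumes "is_tag T"
  shows "tag_counit (basis_vec (class_of T) :: 'k::field tag_space) = (if edges (fst T) = {} then 1 else 0)"
proof -
  have "class_of T = class_of (empty_tag :: (nat, nat) tag) \<longleftrightarrow> edges (fst T) = {}"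
    unfolding class_of_eq_iff[OF assms is_tag_empty] tag_equiv_iff
    by (auto simp: empty_tag_def bij_betw_def)
  moreover have "vector_space ((*) :: 'k \<Rightarrow> 'k \<Rightarrow> 'k)"
    by unfold_locales (auto simp: algebra_simps)
  ultimately show ?thesis by (simp add: tag_counit_def lin_ext_basis_vec)
qed

end

theory Submission
  imports Defs
begin

text \<open>
  All structure maps are linear extensions, so every law is checked on classes of TAGs.
  Coassociativity is the bijection \<open>(B \<subseteq> A) \<mapsto> (B, A - B)\<close> together with
  \<open>(\<Gamma>/B)/C = \<Gamma>/(B \<union> C)\<close>: the connected components of \<open>C\<close> in \<open>\<Gamma>/B\<close> are those of \<open>B \<union> C\<close> in
  \<open>\<Gamma>\<close>, cut into components of \<open>B\<close>. Multiplicativity of the coproduct holds because a set of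
  edges of a disjoint union is a pair of sets of edges, and subgraphs and shrinkings are formed
  on each side separately.
\<close>

section \<open>Isomorphisms of subgraphs and shrinkings\<close>

text \<open>The vertices that count are exactly the endpoints of edges, so matching endpoint sets
  already make \<open>f\<close> surjective; for \<open>f\<close>, only injectivity remains to be
  checked besides.\<close>

lemma tag_equivI:
  assumes "edges (fst T) = g ` edges (fst S)" "inj_on g (edges (fst S))"
    and "inj_on f (\<Union>e\<in>edges (fst S). ends (fst S) e)"
    and "\<And>e. e \<in> edges (fst S) \<Longrightarrow> ends (fst T) (g e) = f ` ends (fst S) e"
    and "\<And>e e'. e \<in> edges (fst S) \<Longrightarrow> e' \<in> edges (fst S) \<Longrightarrow> (g e, g e') \<in> snd T \<longleftrightarrow> (e, e') \<in> snd S"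
  shows "tag_equiv S T"
  unfolding tag_equiv_iff
proof (intro exI conjI ballI)
  show "bij_betw f (\<Union>e\<in>edges (fst S). ends (fst S) e) (\<Union>e\<in>edges (fst T). ends (fst T) e)"
    using assms(1,3,4) by (simp add: bij_betw_def image_UN)
  show "bij_betw g (edges (fst S)) (edges (fst T))"
    using assms(1,2) by (simp add: bij_betw_def)
qed (use assms(4,5) in blast)+

lemma tag_equiv_same_edges:
  assumes "edges (fst T) = edges (fst S)"
    and "\<And>e. e \<in> edges (fst S) \<Longrightarrow> ends (fst T) e = ends (fst S) e"
    and "\<And>e e'. e \<in> edges (fst S) \<Longrightarrow> e' \<in> edges (fst S) \<Longrightarrow> (e, e') \<in> snd T \<longleftrightarrow> (e, e') \<in> snd S"
  shows "tag_equiv S T"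
  by (rule tag_equivI[where f = id and g = id]) (use assms in simp_all)

lemma edges_subtag [simp]: "edges (fst (subtag T A)) = A"
  and ends_subtag [simp]: "ends (fst (subtag T A)) = ends (fst T)"
  and order_subtag [simp]: "snd (subtag T A) = Restr (snd T) A"
  by (simp_all add: subtag_def subgraph_def)

lemma edges_shrink_tag [simp]: "edges (fst (shrink_tag T A)) = edges (fst T) - A"
  and ends_shrink_tag [simp]:
    "ends (fst (shrink_tag T A)) e = component (subgraph (fst T) A) ` ends (fst T) e"
  and order_shrink_tag [simp]: "snd (shrink_tag T A) = Restr (snd T) (edges (fst T) - A)"
  by (simp_all add: shrink_tag_def shrink_graph_def)

lemma edges_disj_tag [simp]: "edges (fst (disj_tag S T)) = edges (fst S) <+> edges (fst T)"
  and ends_disj_tag_Inl [simp]: "ends (fst (disj_tag S T)) (Inl e) = Inl ` ends (fst S) e"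
  and ends_disj_tag_Inr [simp]: "ends (fst (disj_tag S T)) (Inr e') = Inr ` ends (fst T) e'"
  by (simp_all add: disj_tag_def disj_graph_def)

lemma order_disj_tag [simp]:
  "(Inl a, Inl b) \<in> snd (disj_tag S T) \<longleftrightarrow> (a, b) \<in> snd S"
  "(Inr c, Inr d) \<in> snd (disj_tag S T) \<longleftrightarrow> (c, d) \<in> snd T"
  "(Inl a, Inr d) \<in> snd (disj_tag S T) \<longleftrightarrow> a \<in> edges (fst S) \<and> d \<in> edges (fst T)"
  "(Inr c, Inl b) \<notin> snd (disj_tag S T)"
  by (auto simp: disj_tag_def map_prod_def image_iff split: prod.splits intro: bexI)

lemma edges_empty_tag [simp]: "edges (fst empty_tag) = {}"
  by (simp add: empty_tag_def)

lemma finite_edges: "is_tag T \<Longrightarrow> finite (edges (fst T))"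
  by (simp add: is_tag_def is_graph_def)

section \<open>Connected components of subgraphs\<close>

lemma adjacency_subgraph:
  "(x, y) \<in> adjacency (subgraph G A) \<longleftrightarrow> (\<exists>e\<in>A. ends G e = {x, y})"
  by (simp add: adjacency_def subgraph_def)

lemma component_iff: "w \<in> component G v \<longleftrightarrow> (v, w) \<in> (adjacency G)\<^sup>*"
  by (simp add: component_def)

lemma component_self: "v \<in> component G v"
  by (simp add: component_def)

lemma component_nonempty: "component G v \<noteq> {}"
  using component_self[of v G] by blast

text \<open>Endpoint sets are unordered, so adjacency is symmetric and reachability is an
  equivalence relation with the components as its classes.\<close>

lemma component_eq:
  assumes "w \<in> component G v"
  shows "component G w = component G v"
proof -
  have "sym (adjacency G)"
    by (auto simp: sym_def adjacency_def insert_commute)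
  then have "sym ((adjacency G)\<^sup>*)" by (rule sym_rtrancl)
  with assms show ?thesis
    unfolding component_def by (auto intro: rtrancl_trans dest: symD)
qed

lemma component_mono:
  assumes "A \<subseteq> B"
  shows "component (subgraph G A) v \<subseteq> component (subgraph G B) v"
proof -
  have "adjacency (subgraph G A) \<subseteq> adjacency (subgraph G B)"
    using assms by (intro subrelI) (simp add: adjacency_subgraph, blast)
  from rtrancl_mono[OF this] show ?thesis by (auto simp: component_def)
qed

lemma component_subgraph_empty: "component (subgraph G {}) v = {v}"
proof -
  have "adjacency (subgraph G {}) = {}" by (auto simp: adjacency_subgraph)
  then show ?thesis by (simp add: component_def)
qed

text \<open>The hypothesis lets single steps both project and lift along \<open>f\<close>; by
  induction the walks from \<open>f v\<close> are the images of the walks from \<open>v\<close>. It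
  is applied to the two injections into a disjoint union.\<close>

lemma component_closed_image:
  assumes "\<And>x y. (f x, y) \<in> adjacency H \<longleftrightarrow> (\<exists>z. y = f z \<and> (x, z) \<in> adjacency G)"
  shows "component H (f v) = f ` component G v"
proof -
  have "\<exists>w. x = f w \<and> (v, w) \<in> (adjacency G)\<^sup>*" if "(f v, x) \<in> (adjacency H)\<^sup>*" for x
    using that
  proof induction
    case base
    then show ?case by blast
  next
    case (step y z)
    then show ?case using assms by (metis rtrancl_into_rtrancl)
  qed
  moreover have "(f v, f w) \<in> (adjacency H)\<^sup>*" if "(v, w) \<in> (adjacency G)\<^sup>*" for w
    using that
  proof induction
    case (step y z)
    then show ?case using assms by (metis rtrancl_into_rtrancl)
  qed simp
  ultimately show ?thesis by (auto simp: component_def)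
qed

section \<open>Iterated subgraphs and shrinkings\<close>

lemma subtag_all_equiv: "tag_equiv (subtag T (edges (fst T))) T"
  by (rule tag_equiv_same_edges) auto

lemma shrink_tag_empty_equiv: "tag_equiv T (shrink_tag T {})"
  by (rule tag_equivI[where f = "\<lambda>v. {v}" and g = id])
    (auto simp: component_subgraph_empty)

lemma subtag_subtag: "B \<subseteq> A \<Longrightarrow> subtag (subtag T A) B = subtag T B"
  by (auto simp: subtag_def subgraph_def)

text \<open>Both sides contract the components of the same graph, the one formed by
  \<open>B\<close>, so the identity is an isomorphism. This matches the middle tensor factors in
  coassociativity.\<close>

lemma shrink_subtag_equiv:
  assumes "A \<subseteq> edges (fst T)" "B \<subseteq> A"
  shows "tag_equiv (shrink_tag (subtag T A) B) (subtag (shrink_tag T B) (A - B))"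
proof (rule tag_equiv_same_edges)
  have "subgraph (fst (subtag T A)) B = subgraph (fst T) B"
    by (simp add: subtag_def subgraph_def)
  then show "ends (fst (subtag (shrink_tag T B) (A - B))) e = ends (fst (shrink_tag (subtag T A) B)) e" for e
    by simp
qed (use assms in auto)

text \<open>A walk along \<open>C\<close> in the shrinking lifts to a walk along
  \<open>B \<union> C\<close>: where consecutive edges meet only after contraction, the gap is
  bridged inside a component of \<open>B\<close>. Conversely, a walk along
  \<open>B \<union> C\<close> projects to the shrinking, its edges in \<open>B\<close> becoming
  stationary.\<close>

lemma component_shrink_graph:
  assumes card: "\<And>e. e \<in> C \<Longrightarrow> card (ends G e) \<in> {1, 2}"
  shows "component (subgraph (shrink_graph G B) C) (component (subgraph G B) v)
    = component (subgraph G B) ` component (subgraph G (B \<union> C)) v"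
proof -
  let ?c = "component (subgraph G B)" and ?d = "component (subgraph G (B \<union> C))"
  let ?r = "adjacency (subgraph (shrink_graph G B) C)"
  have r: "(X, Y) \<in> ?r \<longleftrightarrow> (\<exists>e\<in>C. ?c ` ends G e = {X, Y})" for X Y
    by (simp add: adjacency_subgraph shrink_graph_def)
  have 1: "X \<in> ?c ` ?d v" if "(?c v, X) \<in> ?r\<^sup>*" for X
    using that
  proof induction
    case base
    show ?case by (intro imageI component_self)
  next
    case (step Y Z)
    then obtain w where w: "w \<in> ?d v" "Y = ?c w" by blast
    from step(2) obtain e where e: "e \<in> C" "?c ` ends G e = {Y, Z}" unfolding r by blast
    \<comment> \<open>The bound on \<open>card\<close> makes the endpoint set a pair that is
      adjacent in \<open>G\<close>, with one end over \<open>Y\<close> and the other over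
      \<open>Z\<close>; for a loop both ends are the same vertex.\<close>
    have "\<exists>u x. ends G e = {u, x} \<and> ?c u = Y \<and> ?c x = Z"
    proof -
      from card[OF e(1)] consider u where "ends G e = {u}" | u x where "ends G e = {u, x}"
        by (auto simp: card_1_singleton_iff card_2_iff)
      then show ?thesis
      proof cases
        case 1
        with e(2) have "?c u = Y" "?c u = Z" by auto
        with 1 show ?thesis by (intro exI[of _ u]) simp
      next
        case 2
        with e(2) have "{?c u, ?c x} = {Y, Z}" by simp
        then consider "?c u = Y" "?c x = Z" | "?c x = Y" "?c u = Z"
          by (auto simp: doubleton_eq_iff)
        then show ?thesis
        proof cases
          case 1
          with 2 show ?thesis by blast
        next
          case 2
          with \<open>ends G e = {u, x}\<close> show ?thesis by (metis insert_commute)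
        qed
      qed
    qed
    then obtain u x where ux: "ends G e = {u, x}" "?c u = ?c w" "?c x = Z" using w(2) by blast
    \<comment> \<open>The lifted edge starts at \<open>u\<close>, which may differ from
      \<open>w\<close>; the two share a component of \<open>B\<close>, so \<open>u\<close> is still
      reached along \<open>B \<union> C\<close>.\<close>
    have "u \<in> ?c w" using component_self[of u "subgraph G B"] unfolding ux(2) .
    then have "u \<in> ?d w" using component_mono[of B "B \<union> C" G w] by blast
    then have "u \<in> ?d v" using component_eq[OF w(1)] by simp
    moreover have "(u, x) \<in> adjacency (subgraph G (B \<union> C))"
      using ux(1) e(1) by (auto simp: adjacency_subgraph)
    ultimately have "x \<in> ?d v" unfolding component_iff by (rule rtrancl_into_rtrancl)
    then show ?case unfolding ux(3)[symmetric] by (rule imageI)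
  qed
  have 2: "(?c v, ?c w) \<in> ?r\<^sup>*" if "(v, w) \<in> (adjacency (subgraph G (B \<union> C)))\<^sup>*" for w
    using that
  proof induction
    case (step w x)
    then obtain e where e: "e \<in> B \<or> e \<in> C" "ends G e = {w, x}"
      by (auto simp: adjacency_subgraph)
    \<comment> \<open>An edge of \<open>B\<close> stays within one vertex of the shrinking; any
      other edge lies in \<open>C\<close> and gives a step there.\<close>
    show ?case
    proof (cases "e \<in> B")
      case True
      then have "x \<in> ?c w"
        using e(2) unfolding component_iff by (intro r_into_rtrancl) (auto simp: adjacency_subgraph)
      then show ?thesis using component_eq step(3) by metis
    next
      case False
      then have "(?c w, ?c x) \<in> ?r" using e unfolding r by (intro bexI[of _ e]) auto
      with step(3) show ?thesis by (rule rtrancl_into_rtrancl)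
    qed
  qed simp
  show ?thesis
  proof (intro equalityI subsetI)
    fix X assume "X \<in> component (subgraph (shrink_graph G B) C) (?c v)"
    then show "X \<in> ?c ` ?d v" unfolding component_iff by (rule 1)
  next
    fix X assume "X \<in> ?c ` ?d v"
    then obtain w where w: "w \<in> ?d v" "X = ?c w" by blast
    then show "X \<in> component (subgraph (shrink_graph G B) C) (?c v)"
      unfolding component_iff w(2) by (intro 2)
  qed
qed

text \<open>The components of \<open>B\<close> through the vertices of a component of
  \<open>A\<close> stay inside it and cover it.\<close>

lemma Union_component_image:
  assumes "B \<subseteq> A"
  shows "\<Union> (component (subgraph G B) ` component (subgraph G A) v) = component (subgraph G A) v"
proof -
  have "component (subgraph G B) w \<subseteq> component (subgraph G A) v"
    if "w \<in> component (subgraph G A) v" for w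
    using component_mono[OF assms] component_eq[OF that] by metis
  moreover have "w \<in> component (subgraph G B) w" for w by (rule component_self)
  ultimately show ?thesis by blast
qed

text \<open>A vertex of the double shrinking is a set of components of \<open>B\<close>;
  \<open>Union\<close> flattens it to a component of \<open>B \<union> C\<close>. This matches the
  last tensor factors in coassociativity.\<close>

lemma shrink_shrink_equiv:
  assumes T: "is_tag T" and C: "C \<subseteq> edges (fst T)"
  shows "tag_equiv (shrink_tag (shrink_tag T B) C) (shrink_tag T (B \<union> C))"
proof (rule tag_equivI[where f = Union and g = id])
  let ?c = "component (subgraph (fst T) B)" and ?d = "component (subgraph (fst T) (B \<union> C))"
  let ?k = "component (subgraph (fst (shrink_tag T B)) C)"
  have k: "?k (?c v) = ?c ` ?d v" for v
    unfolding shrink_tag_def fst_conv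
    by (rule component_shrink_graph) (use T C in \<open>auto simp: is_tag_def is_graph_def\<close>)
  have U: "\<Union> (?c ` ?d v) = ?d v" for v
    by (rule Union_component_image) simp
  show "inj_on Union (\<Union>e\<in>edges (fst (shrink_tag (shrink_tag T B) C)). ends (fst (shrink_tag (shrink_tag T B) C)) e)"
  proof (rule inj_on_inverseI)
    fix X assume "X \<in> (\<Union>e\<in>edges (fst (shrink_tag (shrink_tag T B) C)). ends (fst (shrink_tag (shrink_tag T B) C)) e)"
    then obtain v where "X = ?c ` ?d v" using k by auto
    \<comment> \<open>On these vertices \<open>Union\<close> has an inverse: cut a component of
      \<open>B \<union> C\<close> back into components of \<open>B\<close>.\<close>
    then show "?c ` \<Union> X = X" by (simp only: U)
  qed
  show "ends (fst (shrink_tag T (B \<union> C))) (id e) = \<Union> ` ends (fst (shrink_tag (shrink_tag T B) C)) e" for e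
    by (simp add: image_image k U)
qed auto

section \<open>Disjoint unions\<close>

lemma disj_tag_empty_left_equiv: "tag_equiv T (disj_tag (empty_tag :: ('v, 'e) tag) T)"
  by (rule tag_equivI[where f = Inr and g = Inr]) auto

lemma disj_tag_empty_right_equiv: "tag_equiv T (disj_tag T (empty_tag :: ('v, 'e) tag))"
  by (rule tag_equivI[where f = Inl and g = Inl]) auto

text \<open>Rebracketing the sum types works for vertices and edges alike. It respects the orders
  because either bracketing puts the edges of \<open>R\<close> before those of \<open>S\<close> and
  these before those of \<open>T\<close>.\<close>

lemma disj_tag_assoc_equiv: "tag_equiv (disj_tag (disj_tag R S) T) (disj_tag R (disj_tag S T))"
proof (rule tag_equivI)
  let ?a = "case_sum (case_sum Inl (Inr \<circ> Inl)) (Inr \<circ> Inr)"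
  have inj: "inj_on ?a X" for X :: "(('x + 'y) + 'z) set"
    by (auto simp: inj_on_def split: sum.splits)
  show "inj_on ?a (edges (fst (disj_tag (disj_tag R S) T)))"
    "inj_on ?a (\<Union>e\<in>edges (fst (disj_tag (disj_tag R S) T)). ends (fst (disj_tag (disj_tag R S) T)) e)"
    by (rule inj)+
  show "edges (fst (disj_tag R (disj_tag S T))) = ?a ` edges (fst (disj_tag (disj_tag R S) T))"
    by (simp add: Plus_def image_Un image_image Un_assoc)
  show "ends (fst (disj_tag R (disj_tag S T))) (?a e) = ?a ` ends (fst (disj_tag (disj_tag R S) T)) e" for e
    by (cases e; cases "projl e") (auto simp: image_image)
  show "(?a e, ?a e') \<in> snd (disj_tag R (disj_tag S T)) \<longleftrightarrow> (e, e') \<in> snd (disj_tag (disj_tag R S) T)"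
    if "e \<in> edges (fst (disj_tag (disj_tag R S) T))" "e' \<in> edges (fst (disj_tag (disj_tag R S) T))" for e e'
    using that by auto
qed

lemma subtag_disj_equiv:
  assumes "A \<subseteq> edges (fst S)" "B \<subseteq> edges (fst T)"
  shows "tag_equiv (disj_tag (subtag S A) (subtag T B)) (subtag (disj_tag S T) (A <+> B))"
  by (rule tag_equiv_same_edges) (use assms in auto)

text \<open>No edge joins the two sides, so a walk never leaves the side on which it starts.\<close>

lemma component_subgraph_disj:
  "component (subgraph (fst (disj_tag S T)) (A <+> B)) (Inl v) = Inl ` component (subgraph (fst S) A) v"
  "component (subgraph (fst (disj_tag S T)) (A <+> B)) (Inr w) = Inr ` component (subgraph (fst T) B) w"
proof -
  \<comment> \<open>An edge from the left with one end \<open>Inl x\<close> has its other end on the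
    left too; this is the lifting of steps that \<open>component_closed_image\<close> asks
    for.\<close>
  have l: "Inl ` X = {Inl x, y} \<longleftrightarrow> (\<exists>z. y = Inl z \<and> X = {x, z})" for X :: "'x set" and x and y :: "'x + 'y"
  proof (cases y)
    case (Inl z)
    have "{Inl x, Inl z} = Inl ` {x, z}" by simp
    then show ?thesis using Inl by (simp only: inj_image_eq_iff[OF inj_Inl]) auto
  next
    case (Inr z)
    have "Inr z \<notin> Inl ` X" by blast
    then show ?thesis using Inr by blast
  qed
  have r: "Inr ` X = {Inr x, y} \<longleftrightarrow> (\<exists>z. y = Inr z \<and> X = {x, z})" for X :: "'x set" and x and y :: "'y + 'x"
  proof (cases y)
    case (Inr z)
    have "{Inr x, Inr z} = Inr ` {x, z}" by simp
    then show ?thesis using Inr by (simp only: inj_image_eq_iff[OF inj_Inr]) auto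
  next
    case (Inl z)
    have "Inl z \<notin> Inr ` X" by blast
    then show ?thesis using Inl by blast
  qed
  have lr: "Inl ` X \<noteq> {Inr x, y}" "Inr ` Z \<noteq> {Inl z, y}"
    for X :: "'x set" and Z :: "'y set" and x z and y :: "'x + 'y"
    by blast+
  show "component (subgraph (fst (disj_tag S T)) (A <+> B)) (Inl v) = Inl ` component (subgraph (fst S) A) v"
    by (rule component_closed_image) (auto simp: adjacency_subgraph Plus_def bex_Un l lr)
  show "component (subgraph (fst (disj_tag S T)) (A <+> B)) (Inr w) = Inr ` component (subgraph (fst T) B) w"
    by (rule component_closed_image) (auto simp: adjacency_subgraph Plus_def bex_Un r lr)
qed

lemma shrink_disj_equiv:
  "tag_equiv (disj_tag (shrink_tag S A) (shrink_tag T B)) (shrink_tag (disj_tag S T) (A <+> B))"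
proof (rule tag_equivI[where f = "case_sum ((`) Inl) ((`) Inr)" and g = id])
  show "inj_on (case_sum ((`) Inl) ((`) Inr))
    (\<Union>e\<in>edges (fst (disj_tag (shrink_tag S A) (shrink_tag T B))). ends (fst (disj_tag (shrink_tag S A) (shrink_tag T B))) e)"
    (is "inj_on ?f ?V")
  proof (rule inj_onI)
    \<comment> \<open>\<open>?f\<close> is injective only on nonempty sets: \<open>Inl ` {} = Inr ` {}\<close>.\<close>
    have ne: "Inl {} \<notin> ?V" "Inr {} \<notin> ?V"
      by (auto simp: component_nonempty component_nonempty[symmetric])
    have mixed: "Inl ` X = Inr ` Y \<longleftrightarrow> X = {} \<and> Y = {}" "Inr ` Y = Inl ` X \<longleftrightarrow> X = {} \<and> Y = {}"
      for X :: "'x set" and Y :: "'y set"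
      by blast+
    \<comment> \<open>If the tags of \<open>x\<close> and \<open>y\<close> differed, equal images
      would force both sets to be empty, so it suffices to exclude the empty set for
      \<open>x\<close>.\<close>
    fix x y assume "x \<in> ?V" and eq: "?f x = ?f y"
    have "x \<noteq> Inl {}" by (rule notI) (use ne(1) \<open>x \<in> ?V\<close> in \<open>simp only: not_True_eq_False\<close>)
    have "x \<noteq> Inr {}" by (rule notI) (use ne(2) \<open>x \<in> ?V\<close> in \<open>simp only: not_True_eq_False\<close>)
    with \<open>x \<noteq> Inl {}\<close> eq show "x = y"
      by (cases x; cases y) (simp_all add: inj_image_eq_iff mixed)
  qed
  show "ends (fst (shrink_tag (disj_tag S T) (A <+> B))) (id e)
    = case_sum ((`) Inl) ((`) Inr) ` ends (fst (disj_tag (shrink_tag S A) (shrink_tag T B))) e" for e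
    by (cases e) (simp_all add: image_image component_subgraph_disj)
qed auto

section \<open>Linear algebra of free vector spaces\<close>

lemma vector_space_mult: "vector_space ((*) :: 'k::field \<Rightarrow> 'k \<Rightarrow> 'k)"
  by unfold_locales (auto simp: algebra_simps)

lemma linear_id_vscale: "Vector_Spaces.linear vscale vscale (\<lambda>x. x)"
  using vector_space_vscale by (simp add: Vector_Spaces.linear_iff)

text \<open>Here the vector \<open>p\<close> is fixed and the values at basis elements vary linearly
  with \<open>q\<close>; this yields linearity of \<open>tensor_mult\<close> in its second
  argument.\<close>

lemma linear_lin_ext_param:
  assumes "vector_space s" "\<And>a. Vector_Spaces.linear vscale s (F a)"
  shows "Vector_Spaces.linear vscale s (\<lambda>q. lin_ext s (\<lambda>a. F a q) p)"
proof -
  interpret vector_space s by fact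
  have F: "F a (x + y) = F a x + F a y" "F a (vscale c x) = s c (F a x)" for a c x y
    using assms(2)[of a] by (simp_all add: Vector_Spaces.linear_iff)
  show ?thesis
    unfolding Vector_Spaces.linear_iff lin_ext_def
    by (auto simp: assms(1) vector_space_vscale F scale_right_distrib sum.distrib scale_sum_right
        mult.commute)
qed

lemma bilin_compose_linear:
  assumes "bilin vscale B" "Vector_Spaces.linear vscale s L"
  shows "bilin s (\<lambda>x y. L (B x y))"
  using assms unfolding bilin_def
  by (auto intro: Vector_Spaces.linear_compose[unfolded o_def])

lemma bilin_compose_args:
  assumes "bilin s B" "Vector_Spaces.linear vscale vscale f" "Vector_Spaces.linear vscale vscale g"
  shows "bilin s (\<lambda>x y. B (f x) (g y))"
proof -
  have 1: "Vector_Spaces.linear vscale s (B x)" "Vector_Spaces.linear vscale s (\<lambda>x. B x y)" for x y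
    using assms(1) by (auto simp: bilin_def)
  show ?thesis
    using Vector_Spaces.linear_compose[OF assms(3) 1(1)] Vector_Spaces.linear_compose[OF assms(2) 1(2)]
    by (simp add: bilin_def o_def)
qed

lemma bilin_eq_on_basis:
  assumes f: "bilin s F" and g: "bilin s G"
    and eq: "\<And>a b. F (basis_vec a) (basis_vec b) = G (basis_vec a) (basis_vec b)"
  shows "F x y = G x y"
proof (rule linear_eq_on_basis[where f = "\<lambda>x. F x y" and g = "\<lambda>x. G x y"])
  show "Vector_Spaces.linear vscale s (\<lambda>x. F x y)" "Vector_Spaces.linear vscale s (\<lambda>x. G x y)"
    using f g by (auto simp: bilin_def)
  show "F (basis_vec a) y = G (basis_vec a) y" for a
  proof (rule linear_eq_on_basis[where f = "F (basis_vec a)"])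
    show "Vector_Spaces.linear vscale s (F (basis_vec a))" "Vector_Spaces.linear vscale s (G (basis_vec a))"
      using f g by (auto simp: bilin_def)
  qed (rule eq)
qed

lemma linear_sum_image:
  assumes "Vector_Spaces.linear s s' f"
  shows "f (\<Sum>a\<in>A. x a) = (\<Sum>a\<in>A. f (x a))"
proof -
  interpret Vector_Spaces.linear s s' f by fact
  show ?thesis by (rule sum)
qed

section \<open>Maps on tensor products\<close>

lemma tensor_sum_left: "(\<Sum>a\<in>A. x a) \<otimes> y = (\<Sum>a\<in>A. x a \<otimes> y)"
  by (rule linear_sum_image[OF linear_tensor(2)])

lemma tensor_sum_right: "y \<otimes> (\<Sum>a\<in>A. x a) = (\<Sum>a\<in>A. y \<otimes> x a)"
  by (rule linear_sum_image[OF linear_tensor(1)])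

lemma linear_tensor_lift:
  "vector_space s \<Longrightarrow> Vector_Spaces.linear vscale s (tensor_lift s B)"
  unfolding tensor_lift_def by (rule linear_lin_ext)

lemma linear_tensor_map: "Vector_Spaces.linear vscale vscale (tensor_map f g)"
  unfolding tensor_map_def by (rule linear_tensor_lift[OF vector_space_vscale])

lemma tensor_map_tensor:
  assumes "Vector_Spaces.linear vscale vscale f" "Vector_Spaces.linear vscale vscale g"
  shows "tensor_map f g (x \<otimes> y) = f x \<otimes> g y"
  unfolding tensor_map_def
  by (rule tensor_lift_tensor[OF vector_space_vscale bilin_compose_args[OF bilin_tensor assms]])

lemma linear_tensor_assoc: "Vector_Spaces.linear vscale vscale tensor_assoc"
  unfolding tensor_assoc_def by (rule linear_lin_ext[OF vector_space_vscale])

lemma tensor_assoc_basis_vec: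
  "tensor_assoc ((basis_vec a \<otimes> basis_vec b) \<otimes> basis_vec c) = basis_vec a \<otimes> basis_vec b \<otimes> basis_vec c"
  by (simp add: tensor_assoc_def tensor_basis_vec lin_ext_basis_vec[OF vector_space_vscale])

lemma bilin_tensor_mult: "bilin vscale m \<Longrightarrow> bilin vscale (tensor_mult m)"
proof -
  assume m: "bilin vscale m"
  \<comment> \<open>Only the outer lift is unfolded: it is a linear extension in \<open>p\<close>
    whose values, the inner lifts, are linear in \<open>q\<close>.\<close>
  have "Vector_Spaces.linear vscale vscale (tensor_mult m p)" for p
    unfolding tensor_mult_def tensor_lift_def[of _ "\<lambda>x y. tensor_lift vscale (\<lambda>x' y'. m x x' \<otimes> m y y') q" for q] split_beta
    by (intro linear_lin_ext_param linear_tensor_lift vector_space_vscale)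
  moreover have "Vector_Spaces.linear vscale vscale (\<lambda>p. tensor_mult m p q)" for q
    unfolding tensor_mult_def by (rule linear_tensor_lift[OF vector_space_vscale])
  ultimately show ?thesis by (simp add: bilin_def)
qed

lemma tensor_mult_basis_vec:
  "tensor_mult m (basis_vec a \<otimes> basis_vec b) (basis_vec c \<otimes> basis_vec d)
    = m (basis_vec a) (basis_vec c) \<otimes> m (basis_vec b) (basis_vec d)"
  by (simp add: tensor_mult_def tensor_lift_def tensor_basis_vec lin_ext_basis_vec[OF vector_space_vscale])

section \<open>The bialgebra of TAGs\<close>

text \<open>The quotient is by a partial equivalence whose domain consists of the TAGs, so the
  chosen representative of a class is a TAG.\<close>

lemma tag_class_cases:
  obtains T :: "(nat, nat) tag" where "is_tag T" "X = class_of T"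
proof (rule that)
  show T: "is_tag (rep_tag_class X)"
    using Quotient3_rep_reflp[OF Quotient3_tag_class, of X] by simp
  show "X = class_of (rep_tag_class X)"
    using class_of_nat_tag[OF T] Quotient3_abs_rep[OF Quotient3_tag_class] by metis
qed

lemma bilin_tag_mult: "bilin vscale (tag_mult :: 'k::field tag_space \<Rightarrow> _)"
  unfolding tag_mult_def
  by (rule bilin_compose_linear[OF bilin_tensor linear_lin_ext[OF vector_space_vscale]])

lemma linear_tag_comult: "Vector_Spaces.linear vscale vscale (tag_comult :: 'k::field tag_space \<Rightarrow> _)"
  unfolding tag_comult_def by (rule linear_lin_ext[OF vector_space_vscale])

lemma linear_tag_counit: "Vector_Spaces.linear vscale (*) (tag_counit :: 'k::field tag_space \<Rightarrow> _)"
  unfolding tag_counit_def by (rule linear_lin_ext[OF vector_space_mult])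

lemma linear_tag_mult:
  "Vector_Spaces.linear vscale vscale (tag_mult (x :: 'k::field tag_space))"
  "Vector_Spaces.linear vscale vscale (\<lambda>x :: 'k::field tag_space. tag_mult x y)"
  using bilin_tag_mult unfolding bilin_def by blast+

section \<open>The algebra laws\<close>

text \<open>Both sides are trilinear: bilinearity in \<open>y\<close> and \<open>z\<close> settles
  the case of a basis vector in the first argument, and linearity in \<open>x\<close> the
  rest.\<close>

lemma tag_mult_assoc: "tag_mult (tag_mult x y) z = tag_mult x (tag_mult y (z :: 'k::field tag_space))"
proof -
  have basis: "tag_mult (tag_mult (basis_vec X) (basis_vec Y)) (basis_vec Z)
    = tag_mult (basis_vec X) (tag_mult (basis_vec Y) (basis_vec Z :: 'k tag_space))" for X Y Z
  proof -
    obtain R S T :: "(nat, nat) tag"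
      where "is_tag R" "is_tag S" "is_tag T" "X = class_of R" "Y = class_of S" "Z = class_of T"
      using tag_class_cases by metis
    then show ?thesis
      by (simp add: tag_mult_class_of is_tag_disj_tag class_of_cong[OF disj_tag_assoc_equiv])
  qed
  have "tag_mult (tag_mult (basis_vec X) y) z = tag_mult (basis_vec X) (tag_mult y z)" for X
  proof (rule bilin_eq_on_basis[where F = "\<lambda>y z. tag_mult (tag_mult (basis_vec X) y) z"])
    show "bilin vscale (\<lambda>y z :: 'k tag_space. tag_mult (tag_mult (basis_vec X) y) z)"
      by (rule bilin_compose_args[OF bilin_tag_mult linear_tag_mult(1) linear_id_vscale])
    show "bilin vscale (\<lambda>y z :: 'k tag_space. tag_mult (basis_vec X) (tag_mult y z))"
      by (rule bilin_compose_linear[OF bilin_tag_mult linear_tag_mult(1)])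
  qed (rule basis)
  then show ?thesis
    by (rule linear_eq_on_basis[where f = "\<lambda>x. tag_mult (tag_mult x y) z" and s = vscale, rotated 2])
      (rule Vector_Spaces.linear_compose[OF linear_tag_mult(2) linear_tag_mult(2), unfolded o_def]
        linear_tag_mult(2))+
qed

lemma tag_mult_one:
  "tag_mult tag_one x = (x :: 'k::field tag_space)" "tag_mult x tag_one = x"
proof -
  have basis: "tag_mult tag_one (basis_vec X) = (basis_vec X :: 'k tag_space)"
    "tag_mult (basis_vec X) tag_one = (basis_vec X :: 'k tag_space)" for X
  proof -
    obtain T :: "(nat, nat) tag" where "is_tag T" "X = class_of T" by (rule tag_class_cases)
    then show "tag_mult tag_one (basis_vec X) = (basis_vec X :: 'k tag_space)"
      "tag_mult (basis_vec X) tag_one = (basis_vec X :: 'k tag_space)"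
      by (simp_all add: tag_one_def tag_mult_class_of is_tag_empty
          class_of_cong[OF disj_tag_empty_left_equiv, symmetric] class_of_cong[OF disj_tag_empty_right_equiv, symmetric])
  qed
  show "tag_mult tag_one x = x"
    by (rule linear_eq_on_basis[OF linear_tag_mult(1) linear_id_vscale basis(1)])
  show "tag_mult x tag_one = x"
    by (rule linear_eq_on_basis[OF linear_tag_mult(2) linear_id_vscale basis(2)])
qed

section \<open>The coalgebra laws\<close>

lemma tag_comult_coassoc:
  "tensor_assoc (tensor_map tag_comult id (tag_comult x))
    = tensor_map id tag_comult (tag_comult (x :: 'k::field tag_space))"
proof (rule linear_eq_on_basis[where s = vscale
      and f = "\<lambda>x. tensor_assoc (tensor_map tag_comult id (tag_comult x))"])
  show "Vector_Spaces.linear vscale vscale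
      (\<lambda>x :: 'k tag_space. tensor_assoc (tensor_map tag_comult id (tag_comult x)))"
    by (intro Vector_Spaces.linear_compose[unfolded o_def, OF _ linear_tensor_assoc]
        Vector_Spaces.linear_compose[unfolded o_def, OF _ linear_tensor_map] linear_tag_comult)
  show "Vector_Spaces.linear vscale vscale
      (\<lambda>x :: 'k tag_space. tensor_map id tag_comult (tag_comult x))"
    by (intro Vector_Spaces.linear_compose[unfolded o_def, OF _ linear_tensor_map] linear_tag_comult)
  fix X
  obtain T :: "(nat, nat) tag" where T: "is_tag T" and X: "X = class_of T" by (rule tag_class_cases)
  let ?E = "edges (fst T)"
  let ?b = "\<lambda>S. basis_vec (class_of S) :: 'k tag_space"
  have fin: "finite ?E" using T by (rule finite_edges)
  have id: "Vector_Spaces.linear vscale vscale (id :: 'k tag_space \<Rightarrow> _)"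
    using linear_id_vscale by (simp add: id_def)
  \<comment> \<open>The left side sums over chains \<open>B \<subseteq> A \<subseteq> ?E\<close>:
    first \<open>A\<close> is cut out of \<open>T\<close>, then \<open>B\<close> out of
    \<open>A\<close>.\<close>
  have "tensor_assoc (tensor_map tag_comult id (tag_comult (basis_vec X :: 'k tag_space)))
    = (\<Sum>A\<in>Pow ?E. \<Sum>B\<in>Pow A.
        ?b (subtag (subtag T A) B) \<otimes> ?b (shrink_tag (subtag T A) B) \<otimes> ?b (shrink_tag T A))"
    unfolding X by (simp add: tag_comult_class_of T is_tag_subtag linear_sum_image[OF linear_tensor_map]
        linear_sum_image[OF linear_tensor_assoc] tensor_map_tensor[OF linear_tag_comult id]
        tensor_sum_left tensor_assoc_basis_vec)
  also have "\<dots> = (\<Sum>(A, B)\<in>Sigma (Pow ?E) Pow.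
        ?b (subtag (subtag T A) B) \<otimes> ?b (shrink_tag (subtag T A) B) \<otimes> ?b (shrink_tag T A))"
    using fin by (intro sum.Sigma) (auto intro: finite_subset)
  also have "\<dots> = (\<Sum>(B, C)\<in>Sigma (Pow ?E) (\<lambda>B. Pow (?E - B)).
        ?b (subtag T B) \<otimes> ?b (subtag (shrink_tag T B) C) \<otimes> ?b (shrink_tag (shrink_tag T B) C))"
  \<comment> \<open>The new index \<open>C = A - B\<close> ranges over the subsets of
    \<open>?E - B\<close>, the edge set of the shrinking by \<open>B\<close>; the summands then
    agree factor by factor.\<close>
  proof (rule sum.reindex_bij_witness[where i = "\<lambda>(B, C). (B \<union> C, B)" and j = "\<lambda>(A, B). (B, A - B)"])
    fix p assume p: "p \<in> Sigma (Pow ?E) Pow"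
    obtain A B where AB: "p = (A, B)" "A \<subseteq> ?E" "B \<subseteq> A" using p by auto
    have "class_of (shrink_tag (subtag T A) B) = class_of (subtag (shrink_tag T B) (A - B))"
      by (rule class_of_cong[OF shrink_subtag_equiv[OF AB(2,3)]])
    moreover have "class_of (shrink_tag (shrink_tag T B) (A - B)) = class_of (shrink_tag T (B \<union> (A - B)))"
      by (rule class_of_cong[OF shrink_shrink_equiv[OF T]]) (use AB in auto)
    moreover have "B \<union> (A - B) = A" using AB by blast
    ultimately show "(case case p of (A, B) \<Rightarrow> (B, A - B) of
        (B, C) \<Rightarrow> ?b (subtag T B) \<otimes> ?b (subtag (shrink_tag T B) C) \<otimes> ?b (shrink_tag (shrink_tag T B) C))
      = (case p of (A, B) \<Rightarrow>
        ?b (subtag (subtag T A) B) \<otimes> ?b (shrink_tag (subtag T A) B) \<otimes> ?b (shrink_tag T A))"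
      using AB by (simp add: subtag_subtag)
  qed auto
  also have "\<dots> = (\<Sum>B\<in>Pow ?E. \<Sum>C\<in>Pow (?E - B).
        ?b (subtag T B) \<otimes> ?b (subtag (shrink_tag T B) C) \<otimes> ?b (shrink_tag (shrink_tag T B) C))"
    using fin by (intro sum.Sigma[symmetric]) auto
  also have "\<dots> = tensor_map id tag_comult (tag_comult (basis_vec X))"
    unfolding X by (simp add: tag_comult_class_of T is_tag_shrink_tag linear_sum_image[OF linear_tensor_map]
        tensor_map_tensor[OF id linear_tag_comult] tensor_sum_right)
  finally show "tensor_assoc (tensor_map tag_comult id (tag_comult (basis_vec X :: 'k tag_space)))
    = tensor_map id tag_comult (tag_comult (basis_vec X))" .
qed

lemma vscale_simps: "vscale 1 x = x" "vscale 0 x = 0"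
  by (auto intro!: poly_mapping_eqI)

text \<open>The counit kills every class with an edge. On the left only \<open>A = {}\<close>
  survives, and shrinking by it changes nothing. On the right only the full edge set survives: its
  shrinking has isolated vertices only and counts as the unit.\<close>

lemma tag_comult_counit:
  "tensor_lift vscale (\<lambda>y z. vscale (tag_counit y) z) (tag_comult x) = (x :: 'k::field tag_space)"
  "tensor_lift vscale (\<lambda>y z. vscale (tag_counit z) y) (tag_comult x) = x"
proof -
  let ?l = "tensor_lift vscale (\<lambda>y z. vscale (tag_counit y) z) :: _ \<Rightarrow> 'k tag_space"
  let ?r = "tensor_lift vscale (\<lambda>y z. vscale (tag_counit z) y) :: _ \<Rightarrow> 'k tag_space"
  have lin: "Vector_Spaces.linear vscale vscale ?l" "Vector_Spaces.linear vscale vscale ?r"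
    by (rule linear_tensor_lift[OF vector_space_vscale])+
  have val: "?l (basis_vec Y \<otimes> basis_vec Z) = vscale (tag_counit (basis_vec Y)) (basis_vec Z)"
    "?r (basis_vec Y \<otimes> basis_vec Z) = vscale (tag_counit (basis_vec Z)) (basis_vec Y)" for Y Z
    by (simp_all add: tensor_basis_vec tensor_lift_def lin_ext_basis_vec[OF vector_space_vscale])
  have basis: "?l (tag_comult (basis_vec X)) = basis_vec X" "?r (tag_comult (basis_vec X)) = basis_vec X" for X
  proof -
    obtain T :: "(nat, nat) tag" where T: "is_tag T" and X: "X = class_of T" by (rule tag_class_cases)
    let ?E = "edges (fst T)"
    have fin: "finite (Pow ?E)" using finite_edges[OF T] by simp
    have "?l (tag_comult (basis_vec X))
      = (\<Sum>A\<in>Pow ?E. if A = {} then basis_vec (class_of (shrink_tag T A)) else 0)"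
      unfolding X tag_comult_class_of[OF T] linear_sum_image[OF lin(1)]
      by (intro sum.cong refl) (simp add: val tag_counit_class_of is_tag_subtag T vscale_simps)
    also have "\<dots> = basis_vec X"
      using fin by (simp add: X class_of_cong[OF shrink_tag_empty_equiv, symmetric])
    finally show "?l (tag_comult (basis_vec X)) = basis_vec X" .
    have "?r (tag_comult (basis_vec X))
      = (\<Sum>A\<in>Pow ?E. if A = ?E then basis_vec (class_of (subtag T A)) else 0)"
      unfolding X tag_comult_class_of[OF T] linear_sum_image[OF lin(2)]
      by (intro sum.cong refl) (auto simp: val tag_counit_class_of is_tag_shrink_tag T vscale_simps)
    also have "\<dots> = basis_vec X"
      using fin by (simp add: X class_of_cong[OF subtag_all_equiv])
    finally show "?r (tag_comult (basis_vec X)) = basis_vec X" .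
  qed
  show "?l (tag_comult x) = x"
    by (rule linear_eq_on_basis[OF Vector_Spaces.linear_compose[OF linear_tag_comult lin(1), unfolded o_def]
          linear_id_vscale basis(1)])
  show "?r (tag_comult x) = x"
    by (rule linear_eq_on_basis[OF Vector_Spaces.linear_compose[OF linear_tag_comult lin(2), unfolded o_def]
          linear_id_vscale basis(2)])
qed

section \<open>Compatibility of the algebra and coalgebra structures\<close>

text \<open>A subset of a disjoint sum is determined by its preimages under \<open>Inl\<close> and
  \<open>Inr\<close>, which can be prescribed independently.\<close>

lemma sum_Pow_Plus:
  fixes E :: "'x set" and F :: "'y set"
  shows "(\<Sum>X\<in>Pow (E <+> F). f X) = (\<Sum>A\<in>Pow E. \<Sum>B\<in>Pow F. f (A <+> B))"
proof -
  have "bij_betw (\<lambda>(A, B). A <+> B) (Pow E \<times> Pow F) (Pow (E <+> F))"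
  proof (rule bij_betw_byWitness[where f' = "\<lambda>X. (Inl -` X, Inr -` X)"])
    have "(Inl -` X) <+> (Inr -` X) = X" for X :: "('x + 'y) set"
    proof (rule set_eqI)
      show "x \<in> (Inl -` X) <+> (Inr -` X) \<longleftrightarrow> x \<in> X" for x
        by (cases x) auto
    qed
    then show "\<forall>X\<in>Pow (E <+> F). (case (Inl -` X, Inr -` X) of (A, B) \<Rightarrow> A <+> B) = X"
      by simp
  qed auto
  from sum.reindex_bij_betw[OF this, of f] show ?thesis
    by (simp add: sum.cartesian_product case_prod_unfold)
qed

lemma tag_comult_mult:
  "tag_comult (tag_mult x y) = tensor_mult tag_mult (tag_comult x) (tag_comult (y :: 'k::field tag_space))"
proof (rule bilin_eq_on_basis[where F = "\<lambda>x y. tag_comult (tag_mult x y)"])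
  show "bilin vscale (\<lambda>x y :: 'k tag_space. tag_comult (tag_mult x y))"
    by (rule bilin_compose_linear[OF bilin_tag_mult linear_tag_comult])
  show "bilin vscale (\<lambda>x y :: 'k tag_space. tensor_mult tag_mult (tag_comult x) (tag_comult y))"
    by (rule bilin_compose_args[OF bilin_tensor_mult[OF bilin_tag_mult] linear_tag_comult linear_tag_comult])
  fix X Y
  obtain S :: "(nat, nat) tag" where S: "is_tag S" "X = class_of S" by (rule tag_class_cases)
  obtain T :: "(nat, nat) tag" where T: "is_tag T" "Y = class_of T" by (rule tag_class_cases)
  let ?E = "edges (fst S)" and ?F = "edges (fst T)"
  let ?b = "\<lambda>S. basis_vec (class_of S) :: 'k tag_space"
  let ?m = "tensor_mult tag_mult :: (tag_class \<times> tag_class \<Rightarrow>\<^sub>0 'k) \<Rightarrow> _"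
  have lin: "Vector_Spaces.linear vscale vscale (?m p)"
      "Vector_Spaces.linear vscale vscale (\<lambda>p. ?m p q)" for p q
    using bilin_tensor_mult[OF bilin_tag_mult] unfolding bilin_def by blast+
  let ?D = "disj_tag S T"
  have "tag_comult (tag_mult (basis_vec X) (basis_vec Y))
    = (\<Sum>A\<in>Pow (?E <+> ?F). ?b (subtag ?D A) \<otimes> basis_vec (class_of (shrink_tag ?D A)))"
    by (simp add: S T tag_mult_class_of tag_comult_class_of is_tag_disj_tag)
  also have "\<dots> = (\<Sum>A\<in>Pow ?E. \<Sum>B\<in>Pow ?F.
      ?b (disj_tag (subtag S A) (subtag T B)) \<otimes> basis_vec (class_of (disj_tag (shrink_tag S A) (shrink_tag T B))))"
    unfolding sum_Pow_Plus
    by (intro sum.cong refl) (simp add: class_of_cong[OF subtag_disj_equiv] class_of_cong[OF shrink_disj_equiv])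
  also have "\<dots> = ?m (tag_comult (basis_vec X)) (tag_comult (basis_vec Y))"
    unfolding S(2) T(2) tag_comult_class_of[OF S(1)] tag_comult_class_of[OF T(1)]
      linear_sum_image[OF lin(1)] linear_sum_image[OF lin(2)]
    \<comment> \<open>Bilinearity expands the two sums in the opposite order, which
      \<open>sum.swap\<close> corrects.\<close>
    by (subst (2) sum.swap, intro sum.cong refl)
      (simp add: tensor_mult_basis_vec tag_mult_class_of is_tag_subtag is_tag_shrink_tag S(1) T(1))
  finally show "tag_comult (tag_mult (basis_vec X) (basis_vec Y))
    = ?m (tag_comult (basis_vec X)) (tag_comult (basis_vec Y))" .
qed

lemma tag_comult_one: "tag_comult tag_one = tag_one \<otimes> (tag_one :: 'k::field tag_space)"
proof -
  let ?e = "empty_tag :: (nat, nat) tag"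
  have "class_of (subtag ?e {}) = class_of ?e"
    using class_of_cong[OF subtag_all_equiv[of ?e]] by simp
  moreover have "class_of (shrink_tag ?e {}) = class_of ?e"
    by (rule class_of_cong[OF shrink_tag_empty_equiv, symmetric])
  ultimately show ?thesis
    by (simp add: tag_one_def tag_comult_class_of[OF is_tag_empty])
qed

text \<open>On classes the counit tests for the absence of edges, and a disjoint union is edgeless
  exactly when both parts are.\<close>

lemma tag_counit_mult: "tag_counit (tag_mult x y) = tag_counit x * tag_counit (y :: 'k::field tag_space)"
proof (rule bilin_eq_on_basis[where F = "\<lambda>x y. tag_counit (tag_mult x y)"])
  show "bilin (*) (\<lambda>x y :: 'k tag_space. tag_counit (tag_mult x y))"
    by (rule bilin_compose_linear[OF bilin_tag_mult linear_tag_counit])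
  show "bilin (*) (\<lambda>x y :: 'k tag_space. tag_counit x * tag_counit y)"
    using linear_tag_counit unfolding bilin_def Vector_Spaces.linear_iff
    by (auto simp: algebra_simps)
  fix X Y
  obtain S :: "(nat, nat) tag" where S: "is_tag S" "X = class_of S" by (rule tag_class_cases)
  obtain T :: "(nat, nat) tag" where T: "is_tag T" "Y = class_of T" by (rule tag_class_cases)
  show "tag_counit (tag_mult (basis_vec X) (basis_vec Y))
    = tag_counit (basis_vec X) * tag_counit (basis_vec Y :: 'k tag_space)"
    by (simp add: S T tag_mult_class_of tag_counit_class_of is_tag_disj_tag Plus_eq_empty_conv)
qed

theorem mainTheorem6:
  shows "bialgebra (tag_mult :: 'k::field_char_0 tag_space \<Rightarrow> 'k tag_space \<Rightarrow> 'k tag_space)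
           tag_one tag_comult tag_counit"
proof (intro bialgebra.intro unital_assoc_algebra.intro counital_coassoc_coalgebra.intro bialgebra_axioms.intro)
  show "tag_counit (tag_one :: 'k tag_space) = 1"
    by (simp add: tag_one_def tag_counit_class_of is_tag_empty)
qed (rule bilin_tag_mult tag_mult_assoc tag_mult_one linear_tag_comult linear_tag_counit
    tag_comult_coassoc tag_comult_counit tag_comult_mult tag_comult_one tag_counit_mult)+

end
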